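(* Let $\rho$ be a two-qubit density matrix, let $R$ be the real $4\times4$ matrix with elements $R_{ij}=\operatorname{Tr}(\rho(\sigma_i\otimes\sigma_j))$, $i,j\in\{0,1,2,3\}$, and let $R=L_1\Sigma L_2^T$ with $L_1,L_2$ proper orthochronous Lorentz transformations and $\Sigma$ in one of the following two normal forms: (i) $\Sigma=\operatorname{diag}[s_0,s_1,s_2,s_3]$ with $s_0\ge s_1\ge s_2\ge|s_3|$; (ii) $\Sigma=\begin{pmatrix}a&0&0&b\\0&d&0&0\\0&0&-d&0\\c&0&0&a+c-b\end{pmatrix}$ with $a,b,c,d$ real. Then the concurrence $C$ of $\rho$ is given by $$C=\max\left(0,\tfrac12(-s_0+s_1+s_2-s_3)\right)$$ in case (i), and by $C=\max(0,|d|)$ in case (ii).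
   Context: A two-qubit density matrix is a positive semidefinite complex $4\times4$ matrix on $\mathbb{C}^2\otimes\mathbb{C}^2$ of trace one. $\sigma_0=I_2$ and $\sigma_1=\begin{pmatrix}0&1\\1&0\end{pmatrix}$, $\sigma_2=\sigma_y=\begin{pmatrix}0&-i\\i&0\end{pmatrix}$, $\sigma_3=\begin{pmatrix}1&0\\0&-1\end{pmatrix}$ are the Pauli matrices. With $M=\operatorname{diag}[1,-1,-1,-1]$, a proper orthochronous Lorentz transformation is a real $4\times4$ matrix $L$ (indices $0,\dots,3$) with $LML^T=M$, $\det L=1$ and $L_{00}>0$. The concurrence of $\rho$ is $\max(0,\tau_1-\tau_2-\tau_3-\tau_4)$, where $\tau_1\ge\tau_2\ge\tau_3\ge\tau_4$ are the singular values of $X^T(\sigma_y\otimes\sigma_y)X$ for any square matrix $X$ with $\rho=XX^\dagger$ (the value does not depend on the choice of $X$). *)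

theory Defs
  imports "Jordan_Normal_Form.Char_Poly" "Jordan_Normal_Form.Schur_Decomposition"
begin

definition mat_trace :: "'a::comm_monoid_add mat \<Rightarrow> 'a" where
  "mat_trace A = (\<Sum>i<dim_row A. A $$ (i, i))"

definition kronecker :: "'a::times mat \<Rightarrow> 'a mat \<Rightarrow> 'a mat" (infixl \<open>\<otimes>\<^sub>m\<close> 70) where
  "A \<otimes>\<^sub>m B = mat (dim_row A * dim_row B) (dim_col A * dim_col B)
     (\<lambda>(i, j). A $$ (i div dim_row B, j div dim_col B) * B $$ (i mod dim_row B, j mod dim_col B))"

text \<open>In the order on complex numbers, \<open>0 \<le> z\<close> says that \<open>z\<close> is real and nonnegative, so this
  condition includes that \<open>A\<close> is Hermitian.\<close>

definition positive_semidefinite :: "nat \<Rightarrow> complex mat \<Rightarrow> bool" where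
  "positive_semidefinite n A \<longleftrightarrow>
     A \<in> carrier_mat n n \<and> (\<forall>v \<in> carrier_vec n. 0 \<le> (A *\<^sub>v v) \<bullet>c v)"

text \<open>The basis vector \<open>e\<^sub>i \<otimes> e\<^sub>j\<close> (\<open>i, j \<in> {0, 1}\<close>) of the two-qubit space has index \<open>2 i + j\<close>.\<close>

definition two_qubit_density_matrix :: "complex mat \<Rightarrow> bool" where
  "two_qubit_density_matrix \<rho> \<longleftrightarrow> positive_semidefinite 4 \<rho> \<and> mat_trace \<rho> = 1"

definition pauli :: "nat \<Rightarrow> complex mat" where
  "pauli k = mat_of_rows_list 2
     ([ [[1, 0], [0, 1]],
        [[0, 1], [1, 0]],
        [[0, - \<i>], [\<i>, 0]],
        [[1, 0], [0, - 1]] ] ! k)"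

definition minkowski :: "real mat" where
  "minkowski = mat_of_rows_list 4
     [[1, 0, 0, 0],
      [0, - 1, 0, 0],
      [0, 0, - 1, 0],
      [0, 0, 0, - 1]]"

definition proper_orthochronous_lorentz :: "real mat \<Rightarrow> bool" where
  "proper_orthochronous_lorentz L \<longleftrightarrow>
     L \<in> carrier_mat 4 4 \<and> L * minkowski * transpose_mat L = minkowski \<and> det L = 1 \<and> L $$ (0, 0) > 0"

text \<open>Singular values in decreasing order: the square roots of the eigenvalues of the positive
  semidefinite matrix \<open>A\<^sup>\<dagger> A\<close>, repeated according to multiplicity. These eigenvalues are real, so
  \<open>Re\<close> loses nothing.\<close>

definition singular_values :: "complex mat \<Rightarrow> real list" where
  "singular_values A = rev (sorted_list_of_multiset
     (image_mset (\<lambda>z. sqrt (Re z)) (proots (char_poly (mat_adjoint A * A)))))"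

definition concurrence_of_factor :: "complex mat \<Rightarrow> real" where
  "concurrence_of_factor X =
     (let \<tau> = singular_values (transpose_mat X * (pauli 2 \<otimes>\<^sub>m pauli 2) * X)
      in max 0 (\<tau> ! 0 - \<tau> ! 1 - \<tau> ! 2 - \<tau> ! 3))"

text \<open>The common value over all square factors \<open>X\<close> of \<open>\<rho>\<close>. The description is only determinate
  if a factor exists and the value does not depend on it.\<close>

definition concurrence :: "complex mat \<Rightarrow> real" where
  "concurrence \<rho> =
     (THE c. \<exists>X \<in> carrier_mat 4 4. \<rho> = X * mat_adjoint X \<and> c = concurrence_of_factor X)"

end

theory Submission
  imports Defs
begin

text \<open>
  Write \<open>J = \<sigma>\<^sub>y \<otimes> \<sigma>\<^sub>y\<close>. If \<open>K\<^sup>T J K = J\<close>, then \<open>X \<mapsto> K X\<close> is a bijection from the factors of \<open>\<rho>\<close> to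
  those of \<open>K \<rho> K\<^sup>\<dagger>\<close> that keeps \<open>X\<^sup>T J X\<close>, so \<open>\<rho>\<close> and \<open>K \<rho> K\<^sup>\<dagger>\<close> have the same concurrence. Every proper
  orthochronous Lorentz transformation \<open>L\<close> is induced by some \<open>A\<close> with \<open>det A = 1\<close>, in the sense that
  \<open>A \<sigma>\<^sub>i A\<^sup>\<dagger> = \<Sum>\<^sub>k L\<^sub>k\<^sub>i \<sigma>\<^sub>k\<close>: plane rotations and one boost reduce \<open>L\<close> to the identity, and each of them has an
  explicit spinor. Taking \<open>K = A \<otimes> B\<close> for spinors \<open>A, B\<close> of \<open>L\<^sub>1, L\<^sub>2\<close> replaces \<open>R\<close> by \<open>\<Sigma>\<close>. For both normal
  forms the resulting matrix is supported on the diagonal and the antidiagonal, that is, on two real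
  \<open>2 \<times> 2\<close> blocks with rows \<open>(p, d), (d, q)\<close> and \<open>(r, e), (e, s)\<close>. The singular values are then
  \<open>\<surd>(p q) \<plusminus> d\<close> and \<open>\<surd>(r s) \<plusminus> e\<close>, since their squares are the eigenvalues of \<open>J \<rho>\<^sup>T J \<rho>\<close>.
\<close>

section \<open>Matrices\<close>

text \<open>Let X be the indeterminate times the identity. The block matrix with rows
  \<open>(X, A)\<close> and \<open>(B, 1)\<close> has determinant \<open>char_poly (A * B)\<close>.
  Left multiplication by the block matrix with rows \<open>(1, 0)\<close> and
  \<open>(- B, X)\<close> makes it block triangular with diagonal blocks X and
  \<open>X - B A\<close>.\<close>

lemma char_poly_mult_commute:
  fixes A B :: "'a::idom mat"
  assumes A: "A \<in> carrier_mat n n" and B: "B \<in> carrier_mat n n"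
  shows "char_poly (A * B) = char_poly (B * A)"
proof -
  let ?c = "map_mat (\<lambda>a. [:a:]) :: 'a mat \<Rightarrow> 'a poly mat"
  let ?X = "[:0, 1:] \<cdot>\<^sub>m 1\<^sub>m n :: 'a poly mat"
  interpret c: comm_ring_hom "\<lambda>a::'a. [:a:]"
    by unfold_locales auto
  have cA: "?c A \<in> carrier_mat n n" and cB: "?c B \<in> carrier_mat n n" using A B by auto
  have cp: "char_poly (P * Q) = det (?X - ?c P * ?c Q)"
    if "P \<in> carrier_mat n n" "Q \<in> carrier_mat n n" for P Q
  proof -
    have "char_poly_matrix (P * Q) = ?X - ?c P * ?c Q"
      unfolding char_poly_matrix_def c.mat_hom_mult[OF that, symmetric]
      by (rule eq_matI) (use that in auto)
    then show ?thesis by (simp add: char_poly_def)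
  qed
  have X: "?X \<in> carrier_mat n n" by simp
  let ?M = "four_block_mat ?X (?c A) (?c B) (1\<^sub>m n)"
  let ?N = "four_block_mat (1\<^sub>m n) (0\<^sub>m n n) (- ?c B) ?X"
  have M: "?M \<in> carrier_mat (n + n) (n + n)" and N: "?N \<in> carrier_mat (n + n) (n + n)"
    using X by auto
  have dM: "det ?M = char_poly (A * B)"
    using det_four_block_mat[OF X cA cB one_carrier_mat] cp[OF A B] cB X by simp
  have "?N * ?M = four_block_mat ?X (?c A) (0\<^sub>m n n) (?X - ?c B * ?c A)"
  proof -
    have 1: "1\<^sub>m n * ?X + 0\<^sub>m n n * ?c B = ?X" "1\<^sub>m n * ?c A + 0\<^sub>m n n * 1\<^sub>m n = ?c A"
      using cA cB by auto
    have 2: "- ?c B * ?X + ?X * ?c B = 0\<^sub>m n n"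
      using cB by (intro eq_matI) auto
    have 3: "- ?c B * ?c A + ?X * 1\<^sub>m n = ?X - ?c B * ?c A"
      using cA cB by (intro eq_matI) auto
    show ?thesis
      using mult_four_block_mat[OF one_carrier_mat zero_carrier_mat uminus_carrier_mat[OF cB] X X cA cB one_carrier_mat]
      unfolding 1 2 3 .
  qed
  moreover have "det \<dots> = det ?X * det (?X - ?c B * ?c A)"
    by (rule det_four_block_mat_lower_left_zero) (use cA cB X in auto)
  ultimately have "det ?N * det ?M = det ?X * char_poly (B * A)"
    using det_mult[OF N M] cp[OF B A] by simp
  moreover have "det ?N = det ?X"
    by (subst det_four_block_mat_upper_right_zero) (use cB X in auto)
  \<comment> \<open>This determinant is the n-th power of the indeterminate, so it cancels in the
    integral domain of polynomials.\<close>
  moreover have "det ?X \<noteq> 0" by simp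
  ultimately show ?thesis using dM by simp
qed

section \<open>Adjoint matrices\<close>

lemma dim_mat_adjoint[simp]:
  "dim_row (mat_adjoint A) = dim_col A" "dim_col (mat_adjoint A) = dim_row A"
  by (auto simp: mat_adjoint_def)

lemma index_mat_adjoint[simp]:
  "i < dim_col A \<Longrightarrow> j < dim_row A \<Longrightarrow> mat_adjoint A $$ (i, j) = conjugate (A $$ (j, i))"
  by (simp add: mat_adjoint_def mat_of_rows_def)

lemma mat_adjoint_carrier[simp]:
  "mat_adjoint A \<in> carrier_mat n m \<longleftrightarrow> A \<in> carrier_mat m n"
  by (simp only: carrier_mat_def mem_Collect_eq dim_mat_adjoint) blast

lemma mat_adjoint_mult:
  assumes "dim_col A = dim_row B"
  shows "mat_adjoint (A * B) = mat_adjoint B * mat_adjoint A"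
  by (rule eq_matI)
    (use assms in \<open>auto simp: scalar_prod_def sum_conjugate conjugate_dist_mul mult.commute\<close>)

lemma mat_adjoint_one[simp]: "mat_adjoint (1\<^sub>m n) = (1\<^sub>m n :: complex mat)"
  by (rule eq_matI) auto

lemma transpose_adjoint: "transpose_mat (mat_adjoint A) = mat_adjoint (transpose_mat A)"
  by (rule eq_matI) auto

section \<open>Explicit determinants of order two to four\<close>

lemma det_2:
  assumes "A \<in> carrier_mat 2 2"
  shows "det A = A $$ (0,0) * A $$ (1,1) - A $$ (0,1) * A $$ (1,0)"
proof -
  have "{..<2} = {0, 1::nat}" by auto
  moreover have "mat_delete A i 0 \<in> carrier_mat 1 1" for i
    using assms by (auto simp: mat_delete_def)
  ultimately show ?thesis
    using assms by (subst laplace_expansion_column[OF assms, of 0])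
      (simp_all add: cofactor_def det_single mat_delete_def)
qed

lemma det_3:
  assumes "A \<in> carrier_mat 3 3"
  shows "det A = A $$ (0,0) * (A $$ (1,1) * A $$ (2,2) - A $$ (1,2) * A $$ (2,1))
    - A $$ (1,0) * (A $$ (0,1) * A $$ (2,2) - A $$ (0,2) * A $$ (2,1))
    + A $$ (2,0) * (A $$ (0,1) * A $$ (1,2) - A $$ (0,2) * A $$ (1,1))"
proof -
  have "{..<3} = {0, 1, 2::nat}" by auto
  moreover have "mat_delete A i 0 \<in> carrier_mat 2 2" for i
    using assms by (auto simp: mat_delete_def)
  ultimately show ?thesis
    using assms by (subst laplace_expansion_column[OF assms, of 0])
      (simp_all add: cofactor_def det_2 mat_delete_def eval_nat_numeral algebra_simps)
qed

lemma det_4: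
  assumes "A \<in> carrier_mat 4 4"
  shows "det A =
      A $$ (0,0) * (A $$ (1,1) * (A $$ (2,2) * A $$ (3,3) - A $$ (2,3) * A $$ (3,2))
        - A $$ (2,1) * (A $$ (1,2) * A $$ (3,3) - A $$ (1,3) * A $$ (3,2))
        + A $$ (3,1) * (A $$ (1,2) * A $$ (2,3) - A $$ (1,3) * A $$ (2,2)))
    - A $$ (1,0) * (A $$ (0,1) * (A $$ (2,2) * A $$ (3,3) - A $$ (2,3) * A $$ (3,2))
        - A $$ (2,1) * (A $$ (0,2) * A $$ (3,3) - A $$ (0,3) * A $$ (3,2))
        + A $$ (3,1) * (A $$ (0,2) * A $$ (2,3) - A $$ (0,3) * A $$ (2,2)))
    + A $$ (2,0) * (A $$ (0,1) * (A $$ (1,2) * A $$ (3,3) - A $$ (1,3) * A $$ (3,2))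
        - A $$ (1,1) * (A $$ (0,2) * A $$ (3,3) - A $$ (0,3) * A $$ (3,2))
        + A $$ (3,1) * (A $$ (0,2) * A $$ (1,3) - A $$ (0,3) * A $$ (1,2)))
    - A $$ (3,0) * (A $$ (0,1) * (A $$ (1,2) * A $$ (2,3) - A $$ (1,3) * A $$ (2,2))
        - A $$ (1,1) * (A $$ (0,2) * A $$ (2,3) - A $$ (0,3) * A $$ (2,2))
        + A $$ (2,1) * (A $$ (0,2) * A $$ (1,3) - A $$ (0,3) * A $$ (1,2)))"
proof -
  have "{..<4} = {0, 1, 2, 3::nat}" by auto
  moreover have "mat_delete A i 0 \<in> carrier_mat 3 3" for i
    using assms by (auto simp: mat_delete_def)
  ultimately show ?thesis
    using assms by (subst laplace_expansion_column[OF assms, of 0])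
      (simp_all add: cofactor_def det_3 mat_delete_def eval_nat_numeral algebra_simps)
qed

lemma mat_trace_mult_4:
  assumes "A \<in> carrier_mat 4 4" "B \<in> carrier_mat 4 4"
  shows "mat_trace (A * B) = (\<Sum>m<4. \<Sum>n<4. A $$ (m, n) * B $$ (n, m))"
  using assms by (simp add: mat_trace_def scalar_prod_def lessThan_atLeast0)

text \<open>Linearity of \<open>M \<mapsto> K M K'\<close>, over an arbitrary index set so that it
  applies to sums over pairs of Pauli indices.\<close>

lemma index_mult_linear:
  fixes K K' :: "'a::comm_semiring_0 mat"
  assumes K: "K \<in> carrier_mat n n" and K': "K' \<in> carrier_mat n n"
    and H: "\<And>p. p \<in> P \<Longrightarrow> H p \<in> carrier_mat n n" and ij: "i < n" "j < n"
  shows "(K * mat n n (\<lambda>(u, v). \<Sum>p\<in>P. c p * H p $$ (u, v)) * K') $$ (i, j) =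
    (\<Sum>p\<in>P. c p * (K * H p * K') $$ (i, j))"
proof -
  have triple: "(K * M * K') $$ (i, j) = (\<Sum>v<n. \<Sum>u<n. K $$ (i,u) * M $$ (u,v) * K' $$ (v,j))"
    if M: "M \<in> carrier_mat n n" for M
    using ij carrier_matD[OF K] carrier_matD[OF K'] carrier_matD[OF M]
    by (simp add: scalar_prod_def lessThan_atLeast0 sum_distrib_right)
  have "(K * mat n n (\<lambda>(u, v). \<Sum>p\<in>P. c p * H p $$ (u, v)) * K') $$ (i, j) =
      (\<Sum>v<n. \<Sum>u<n. \<Sum>p\<in>P. c p * (K $$ (i,u) * H p $$ (u,v) * K' $$ (v,j)))"
    by (simp add: triple sum_distrib_left sum_distrib_right mult_ac)
  also have "\<dots> = (\<Sum>v<n. \<Sum>p\<in>P. \<Sum>u<n. c p * (K $$ (i,u) * H p $$ (u,v) * K' $$ (v,j)))"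
    by (intro sum.cong refl sum.swap)
  also have "\<dots> = (\<Sum>p\<in>P. \<Sum>v<n. \<Sum>u<n. c p * (K $$ (i,u) * H p $$ (u,v) * K' $$ (v,j)))"
    by (rule sum.swap)
  also have "\<dots> = (\<Sum>p\<in>P. c p * (K * H p * K') $$ (i, j))"
    by (simp add: triple H sum_distrib_left del: index_mult_mat(1))
  finally show ?thesis .
qed

lemma congruence_cancel:
  fixes K L \<rho> :: "complex mat"
  assumes K: "K \<in> carrier_mat n n" and L: "L \<in> carrier_mat n n" and \<rho>: "\<rho> \<in> carrier_mat n n"
    and LK: "L * K = 1\<^sub>m n"
  shows "L * (K * \<rho> * mat_adjoint K) * mat_adjoint L = \<rho>"
proof -
  note [simp] = K L \<rho> carrier_matD[OF K] carrier_matD[OF L] mult_carrier_mat[of _ n n _ n]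
  have "mat_adjoint K * mat_adjoint L = 1\<^sub>m n"
    by (simp add: mat_adjoint_mult[symmetric] LK)
  moreover have "L * (K * \<rho> * mat_adjoint K) * mat_adjoint L =
      (L * K) * \<rho> * (mat_adjoint K * mat_adjoint L)"
    by (simp add: assoc_mult_mat[of _ n n _ n _ n])
  ultimately show ?thesis
    by (simp add: LK left_mult_one_mat[OF \<rho>] right_mult_one_mat[OF \<rho>])
qed

text \<open>Moving \<open>L\<close> across the inner product turns the form of the congruent matrix
  at \<open>v\<close> into the form of \<open>A\<close> at
  \<open>mat_adjoint L *\<^sub>v v\<close>.\<close>

lemma positive_semidefinite_congruence:
  assumes A: "positive_semidefinite n A" and L[simp]: "L \<in> carrier_mat n n"
  shows "positive_semidefinite n (L * A * mat_adjoint L)"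
proof -
  have [simp]: "A \<in> carrier_mat n n" using A by (simp add: positive_semidefinite_def)
  have "(L * A * mat_adjoint L *\<^sub>v v) \<bullet>c v = (A *\<^sub>v (mat_adjoint L *\<^sub>v v)) \<bullet>c (mat_adjoint L *\<^sub>v v)"
    if [simp]: "v \<in> carrier_vec n" for v
  proof -
    define w where "w = A *\<^sub>v (mat_adjoint L *\<^sub>v v)"
    have Lv: "mat_adjoint L *\<^sub>v v \<in> carrier_vec n" by (rule mult_mat_vec_carrier[of _ n n]) auto
    then have w[simp]: "w \<in> carrier_vec n" unfolding w_def by (rule mult_mat_vec_carrier[rotated]) simp
    have dims: "dim_vec v = n" "dim_vec w = n" "dim_row L = n" "dim_col L = n"
      using carrier_vecD[OF that] carrier_vecD[OF w] carrier_matD[OF L] by simp_all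
    have "L * A * mat_adjoint L *\<^sub>v v = L *\<^sub>v w"
      unfolding w_def using Lv
      by (simp add: assoc_mult_mat_vec[of _ n n _ n] mult_carrier_mat[of _ n n])
    moreover have "(L *\<^sub>v w) \<bullet>c v = w \<bullet>c (mat_adjoint L *\<^sub>v v)"
    proof -
      have "(L *\<^sub>v w) \<bullet>c v = (\<Sum>i<n. \<Sum>j<n. L $$ (i,j) * w $ j * cnj (v $ i))"
        by (simp add: dims scalar_prod_def lessThan_atLeast0 sum_distrib_right)
      also have "\<dots> = (\<Sum>j<n. \<Sum>i<n. L $$ (i,j) * w $ j * cnj (v $ i))"
        by (rule sum.swap)
      also have "\<dots> = w \<bullet>c (mat_adjoint L *\<^sub>v v)"
        by (simp add: dims scalar_prod_def lessThan_atLeast0 sum_distrib_left mult_ac)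
      finally show ?thesis .
    qed
    ultimately show ?thesis by (simp add: w_def)
  qed
  moreover have "mat_adjoint L *\<^sub>v v \<in> carrier_vec n" if "v \<in> carrier_vec n" for v
    by (rule mult_mat_vec_carrier[of _ n n]) (use that in auto)
  moreover have "\<forall>v \<in> carrier_vec n. 0 \<le> (A *\<^sub>v v) \<bullet>c v"
    using A by (simp add: positive_semidefinite_def)
  ultimately have "\<forall>v \<in> carrier_vec n. 0 \<le> (L * A * mat_adjoint L *\<^sub>v v) \<bullet>c v"
    by metis
  then show ?thesis
    by (simp add: positive_semidefinite_def mult_carrier_mat[of _ n n])
qed

section \<open>Entrywise computation in dimensions two and four\<close>

lemma lessThan_4: "{..<4::nat} = {0, 1, 2, 3}" by auto

lemma sum_2: "sum f {0..<2::nat} = f 0 + f 1"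
  by (simp add: eval_nat_numeral)

lemma less_2_natE:
  fixes i :: nat
  assumes "i < 2"
  obtains "i = 0" | "i = 1"
  using assms by linarith

lemma eq_mat_2I:
  assumes "A \<in> carrier_mat 2 2" "B \<in> carrier_mat 2 2"
    and "A $$ (0,0) = B $$ (0,0)" "A $$ (0,1) = B $$ (0,1)"
    and "A $$ (1,0) = B $$ (1,0)" "A $$ (1,1) = B $$ (1,1)"
  shows "A = B"
proof (rule eq_matI)
  fix i j assume "i < dim_row B" "j < dim_col B"
  then have "i < 2" "j < 2" using assms(2) by auto
  then show "A $$ (i, j) = B $$ (i, j)"
    by (elim less_2_natE) (use assms in auto)
qed (use assms in auto)

lemma index_mult_2:
  assumes "A \<in> carrier_mat 2 2" "B \<in> carrier_mat 2 2" "i < 2" "j < 2"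
  shows "(A * B) $$ (i, j) = A $$ (i,0) * B $$ (0,j) + A $$ (i,1) * B $$ (1,j)"
  using assms by (simp add: scalar_prod_def sum_2)

lemma mult_carrier_2[simp]:
  "A \<in> carrier_mat 2 2 \<Longrightarrow> B \<in> carrier_mat 2 2 \<Longrightarrow> A * B \<in> carrier_mat 2 2"
  by (rule mult_carrier_mat)

lemma less_4_cases:
  fixes i :: nat
  assumes "i < 4"
  obtains "i = 0" | "i = 1" | "i = 2" | "i = 3"
  using assms by linarith

lemma eq_mat_4I:
  assumes "A \<in> carrier_mat 4 4" "B \<in> carrier_mat 4 4"
    and "A $$ (0,0) = B $$ (0,0)" "A $$ (0,1) = B $$ (0,1)" "A $$ (0,2) = B $$ (0,2)" "A $$ (0,3) = B $$ (0,3)"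
    and "A $$ (1,0) = B $$ (1,0)" "A $$ (1,1) = B $$ (1,1)" "A $$ (1,2) = B $$ (1,2)" "A $$ (1,3) = B $$ (1,3)"
    and "A $$ (2,0) = B $$ (2,0)" "A $$ (2,1) = B $$ (2,1)" "A $$ (2,2) = B $$ (2,2)" "A $$ (2,3) = B $$ (2,3)"
    and "A $$ (3,0) = B $$ (3,0)" "A $$ (3,1) = B $$ (3,1)" "A $$ (3,2) = B $$ (3,2)" "A $$ (3,3) = B $$ (3,3)"
  shows "A = B"
proof (rule eq_matI)
  fix i j assume "i < dim_row B" "j < dim_col B"
  then have "i < 4" "j < 4" using assms(2) by auto
  then show "A $$ (i, j) = B $$ (i, j)"
    by (elim less_4_cases) (use assms in auto)
qed (use assms in auto)

lemma sum_4: "sum f {0..<4::nat} = f 0 + f 1 + f 2 + f 3"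
  by (simp add: eval_nat_numeral)

lemma mult_carrier_4[simp]:
  "A \<in> carrier_mat 4 4 \<Longrightarrow> B \<in> carrier_mat 4 4 \<Longrightarrow> A * B \<in> carrier_mat 4 4"
  by (rule mult_carrier_mat)

lemma index_mult_4:
  assumes "A \<in> carrier_mat 4 4" "B \<in> carrier_mat 4 4" "i < 4" "j < 4"
  shows "(A * B) $$ (i, j) = A $$ (i,0) * B $$ (0,j) + A $$ (i,1) * B $$ (1,j)
    + A $$ (i,2) * B $$ (2,j) + A $$ (i,3) * B $$ (3,j)"
  using assms by (simp add: scalar_prod_def sum_4)

section \<open>Kronecker products\<close>

text \<open>The range splits into \<open>m\<close> consecutive blocks of length \<open>n\<close>; on
  block \<open>i\<close> the quotient is \<open>i\<close> and the remainder runs through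
  \<open>0\<close> to \<open>n - 1\<close>.\<close>

lemma sum_div_mod:
  fixes f :: "nat \<Rightarrow> nat \<Rightarrow> 'a::comm_monoid_add"
  shows "(\<Sum>k<m * n. f (k div n) (k mod n)) = (\<Sum>i<m. \<Sum>j<n. f i j)"
proof -
  let ?g = "\<lambda>k. f (k div n) (k mod n)"
  have "sum ?g {i * n..<i * n + n} = (\<Sum>j<n. f i j)" for i
    using sum.shift_bounds_nat_ivl[of ?g 0 "i * n" n] by (simp add: lessThan_atLeast0 add.commute)
  then show ?thesis
    by (simp add: sum.nat_group[of ?g, symmetric])
qed

lemma dim_kronecker[simp]:
  "dim_row (A \<otimes>\<^sub>m B) = dim_row A * dim_row B" "dim_col (A \<otimes>\<^sub>m B) = dim_col A * dim_col B"
  by (simp_all add: kronecker_def)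

lemma kronecker_carrier[simp]:
  "A \<in> carrier_mat m n \<Longrightarrow> B \<in> carrier_mat k l \<Longrightarrow> A \<otimes>\<^sub>m B \<in> carrier_mat (m * k) (n * l)"
  by auto

lemma index_kronecker:
  assumes "i < dim_row A * dim_row B" "j < dim_col A * dim_col B"
  shows "(A \<otimes>\<^sub>m B) $$ (i, j) =
    A $$ (i div dim_row B, j div dim_col B) * B $$ (i mod dim_row B, j mod dim_col B)"
  using assms by (simp add: kronecker_def)

text \<open>The summation index of the left product encodes a pair by quotient and remainder, so the
  sum factors into the sums for \<open>A * C\<close> and \<open>B * D\<close>.\<close>

lemma kronecker_mult:
  fixes A B C D :: "'a::comm_semiring_0 mat"
  assumes "dim_col A = dim_row C" and "dim_col B = dim_row D"
  shows "(A \<otimes>\<^sub>m B) * (C \<otimes>\<^sub>m D) = (A * C) \<otimes>\<^sub>m (B * D)"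
proof (rule eq_matI)
  fix i j assume "i < dim_row ((A * C) \<otimes>\<^sub>m (B * D))" "j < dim_col ((A * C) \<otimes>\<^sub>m (B * D))"
  then have i: "i < dim_row A * dim_row B" and j: "j < dim_col C * dim_col D" by auto
  have i': "i div dim_row B < dim_row A" "i mod dim_row B < dim_row B"
    using i by (auto simp: less_mult_imp_div_less intro!: mod_less_divisor gr0I)
  have j': "j div dim_col D < dim_col C" "j mod dim_col D < dim_col D"
    using j by (auto simp: less_mult_imp_div_less intro!: mod_less_divisor gr0I)
  let ?f = "\<lambda>k l. A $$ (i div dim_row B, k) * B $$ (i mod dim_row B, l) *
    (C $$ (k, j div dim_col D) * D $$ (l, j mod dim_col D))"
  have "((A \<otimes>\<^sub>m B) * (C \<otimes>\<^sub>m D)) $$ (i, j) =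
      (\<Sum>k<dim_row C * dim_row D. ?f (k div dim_row D) (k mod dim_row D))"
    using i j assms by (simp add: scalar_prod_def index_kronecker lessThan_atLeast0)
  also have "\<dots> = (\<Sum>k<dim_row C. \<Sum>l<dim_row D. ?f k l)"
    by (rule sum_div_mod)
  also have "\<dots> = ((A * C) \<otimes>\<^sub>m (B * D)) $$ (i, j)"
    using i j i' j' assms
    by (simp add: index_kronecker scalar_prod_def lessThan_atLeast0 sum_product mult_ac)
  finally show "((A \<otimes>\<^sub>m B) * (C \<otimes>\<^sub>m D)) $$ (i, j) = ((A * C) \<otimes>\<^sub>m (B * D)) $$ (i, j)" .
qed (use assms in auto)

lemma div_mod_bounds:
  fixes i a b :: nat assumes "i < a * b" shows "i div b < a" "i mod b < b"
  using assms by (auto simp: less_mult_imp_div_less intro!: mod_less_divisor gr0I)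

lemma transpose_kronecker:
  "transpose_mat (A \<otimes>\<^sub>m B) = transpose_mat A \<otimes>\<^sub>m transpose_mat B"
  by (rule eq_matI) (auto simp: index_kronecker div_mod_bounds)

lemma adjoint_kronecker:
  "mat_adjoint (A \<otimes>\<^sub>m B) = mat_adjoint A \<otimes>\<^sub>m mat_adjoint B"
  by (rule eq_matI) (auto simp: index_kronecker div_mod_bounds conjugate_dist_mul)

section \<open>Concurrence\<close>

text \<open>These matrices respect the splitting of the indices into {0, 3} and {1, 2}. Products,
  transposes and adjoints keep this shape, so computations reduce to two blocks of order
  two.\<close>

definition x_mat :: "'a \<Rightarrow> 'a \<Rightarrow> 'a \<Rightarrow> 'a \<Rightarrow> 'a \<Rightarrow> 'a \<Rightarrow> 'a \<Rightarrow> 'a \<Rightarrow> 'a::zero mat" where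
  "x_mat a b c d e f g h = mat_of_rows_list 4
     [[a, 0, 0, b],
      [0, c, d, 0],
      [0, e, f, 0],
      [g, 0, 0, h]]"

lemma x_mat_dim[simp]:
  "dim_row (x_mat a b c d e f g h) = 4" "dim_col (x_mat a b c d e f g h) = 4"
  by (simp_all add: x_mat_def mat_of_rows_list_def)

lemma x_mat_carrier[simp]: "x_mat a b c d e f g h \<in> carrier_mat 4 4"
  by (rule carrier_matI) simp_all

lemma index_x_mat[simp]:
  "x_mat a b c d e f g h $$ (0, 0) = a" "x_mat a b c d e f g h $$ (0, Suc 0) = 0" "x_mat a b c d e f g h $$ (0, 2) = 0" "x_mat a b c d e f g h $$ (0, 3) = b"
  "x_mat a b c d e f g h $$ (Suc 0, 0) = 0" "x_mat a b c d e f g h $$ (Suc 0, Suc 0) = c" "x_mat a b c d e f g h $$ (Suc 0, 2) = d" "x_mat a b c d e f g h $$ (Suc 0, 3) = 0"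
  "x_mat a b c d e f g h $$ (2, 0) = 0" "x_mat a b c d e f g h $$ (2, Suc 0) = e" "x_mat a b c d e f g h $$ (2, 2) = f" "x_mat a b c d e f g h $$ (2, 3) = 0"
  "x_mat a b c d e f g h $$ (3, 0) = g" "x_mat a b c d e f g h $$ (3, Suc 0) = 0" "x_mat a b c d e f g h $$ (3, 2) = 0" "x_mat a b c d e f g h $$ (3, 3) = h"
  by (simp_all add: x_mat_def mat_of_rows_list_def)

lemma x_mat_mult:
  fixes a :: "'a::semiring_0"
  shows "x_mat a b c d e f g h * x_mat a' b' c' d' e' f' g' h' =
    x_mat (a * a' + b * g') (a * b' + b * h') (c * c' + d * e') (c * d' + d * f')
      (e * c' + f * e') (e * d' + f * f') (g * a' + h * g') (g * b' + h * h')"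
  by (rule eq_mat_4I) (simp_all add: index_mult_4 del: index_mult_mat(1))

lemma transpose_x_mat:
  "transpose_mat (x_mat a b c d e f g h) = x_mat a g c e d f b h"
  by (rule eq_mat_4I) simp_all

lemma adjoint_x_mat:
  "mat_adjoint (x_mat a b c d e f g h) =
    x_mat (cnj a) (cnj g) (cnj c) (cnj e) (cnj d) (cnj f) (cnj b) (cnj h)"
  by (rule eq_mat_4I) simp_all

lemma one_mat_4: "(1\<^sub>m 4 :: 'a::semiring_1 mat) = x_mat 1 0 1 0 0 1 0 1"
  by (rule eq_mat_4I) simp_all

text \<open>Each of the two blocks contributes its own quadratic factor.\<close>

lemma char_poly_x_mat:
  fixes a :: "'a::comm_ring_1"
  shows "char_poly (x_mat a b c d e f g h) =
    ([:-a, 1:] * [:-h, 1:] - [:b * g:]) * ([:-c, 1:] * [:-f, 1:] - [:d * e:])"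
proof -
  have carr: "char_poly_matrix (x_mat a b c d e f g h) \<in> carrier_mat 4 4"
    by simp
  show ?thesis
    unfolding char_poly_def det_4[OF carr]
    by (simp add: char_poly_matrix_def algebra_simps)
qed

lemma x_mat_eqI:
  assumes "a = a'" "b = b'" "c = c'" "d = d'" "e = e'" "f = f'" "g = g'" "h = h'"
  shows "x_mat a b c d e f g h = x_mat a' b' c' d' e' f' g' h'"
  using assms by simp

section \<open>Pauli matrices and the spin flip\<close>

lemma pauli_dim: "i < 4 \<Longrightarrow> dim_row (pauli i) = 2" "i < 4 \<Longrightarrow> dim_col (pauli i) = 2"
  by (auto elim!: less_4_cases simp: pauli_def mat_of_rows_list_def)

lemma pauli_carrier[simp]: "i < 4 \<Longrightarrow> pauli i \<in> carrier_mat 2 2"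
  by (rule carrier_matI) (simp_all add: pauli_dim)

lemma index_pauli[simp]:
  "pauli 0 $$ (0, 0) = 1" "pauli 0 $$ (0, Suc 0) = 0" "pauli 0 $$ (Suc 0, 0) = 0" "pauli 0 $$ (Suc 0, Suc 0) = 1"
  "pauli (Suc 0) $$ (0, 0) = 0" "pauli (Suc 0) $$ (0, Suc 0) = 1" "pauli (Suc 0) $$ (Suc 0, 0) = 1" "pauli (Suc 0) $$ (Suc 0, Suc 0) = 0"
  "pauli 2 $$ (0, 0) = 0" "pauli 2 $$ (0, Suc 0) = - \<i>" "pauli 2 $$ (Suc 0, 0) = \<i>" "pauli 2 $$ (Suc 0, Suc 0) = 0"
  "pauli 3 $$ (0, 0) = 1" "pauli 3 $$ (0, Suc 0) = 0" "pauli 3 $$ (Suc 0, 0) = 0" "pauli 3 $$ (Suc 0, Suc 0) = - 1"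
  by (simp_all add: pauli_def mat_of_rows_list_def)

definition spin_flip :: "complex mat" where
  "spin_flip = pauli 2 \<otimes>\<^sub>m pauli 2"

lemma spin_flip_x_mat: "spin_flip = x_mat 0 (- 1) 0 1 1 0 (- 1) 0"
proof -
  have "spin_flip \<in> carrier_mat (2 * 2) (2 * 2)"
    unfolding spin_flip_def by (intro kronecker_carrier) simp_all
  then show ?thesis
    by (intro eq_mat_4I) (simp_all add: spin_flip_def index_kronecker pauli_dim)
qed

lemma spin_flip_carrier[simp]: "spin_flip \<in> carrier_mat 4 4"
  by (simp add: spin_flip_x_mat)

lemma spin_flip_dim[simp]: "dim_row spin_flip = 4" "dim_col spin_flip = 4"
  by (simp_all add: spin_flip_x_mat)

lemma spin_flip_involution: "spin_flip * spin_flip = 1\<^sub>m 4"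
  by (simp add: spin_flip_x_mat x_mat_mult one_mat_4)

lemma spin_flip_hermitian: "mat_adjoint spin_flip = spin_flip"
  by (simp add: spin_flip_x_mat adjoint_x_mat)

text \<open>Isometries of the complex bilinear form with matrix \<open>spin_flip\<close>. The
  transpose is taken without conjugation, as in the matrix whose singular values define the
  concurrence.\<close>

definition spin_flip_isometry :: "complex mat \<Rightarrow> bool" where
  "spin_flip_isometry K \<longleftrightarrow> K \<in> carrier_mat 4 4 \<and> transpose_mat K * spin_flip * K = spin_flip"

text \<open>Since \<open>spin_flip\<close> squares to the identity, the isometry equation itself
  exhibits the inverse, namely \<open>spin_flip * transpose_mat K * spin_flip\<close>.\<close>

lemma spin_flip_isometry_inverse:
  assumes "spin_flip_isometry K"
  obtains L where "spin_flip_isometry L" "L * K = 1\<^sub>m 4" "K * L = 1\<^sub>m 4"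
proof -
  define L where "L = spin_flip * transpose_mat K * spin_flip"
  have K[simp]: "K \<in> carrier_mat 4 4" and KJK: "transpose_mat K * spin_flip * K = spin_flip"
    using assms by (auto simp: spin_flip_isometry_def)
  have KT[simp]: "transpose_mat K \<in> carrier_mat 4 4" by simp
  have L[simp]: "L \<in> carrier_mat 4 4" by (simp add: L_def)
  have "L * K = spin_flip * (transpose_mat K * spin_flip * K)"
    by (simp add: L_def assoc_mult_mat[of _ 4 4 _ 4 _ 4] del: transpose_carrier_mat)
  then have LK: "L * K = 1\<^sub>m 4" by (simp add: KJK spin_flip_involution)
  then have KL: "K * L = 1\<^sub>m 4" by (rule mat_mult_left_right_inverse[OF L K])
  have "transpose_mat L * spin_flip * L = transpose_mat L * (transpose_mat K * spin_flip * K) * L"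
    by (simp add: KJK)
  also have "\<dots> = (transpose_mat L * transpose_mat K) * spin_flip * (K * L)"
    by (simp add: assoc_mult_mat[of _ 4 4 _ 4 _ 4])
  also have "transpose_mat L * transpose_mat K = 1\<^sub>m 4"
    using transpose_mult[OF K L] KL by simp
  finally have "spin_flip_isometry L" by (simp add: spin_flip_isometry_def KL)
  then show ?thesis using LK KL that by blast
qed

text \<open>In the bilinear form of \<open>K * X\<close> the isometry cancels, so the matrix whose
  singular values are taken stays literally the same.\<close>

lemma factor_congruence:
  assumes "spin_flip_isometry K" and X: "X \<in> carrier_mat 4 4"
  shows "K * (X * mat_adjoint X) * mat_adjoint K = (K * X) * mat_adjoint (K * X)"
    and "concurrence_of_factor (K * X) = concurrence_of_factor X"
proof -
  have K[simp]: "K \<in> carrier_mat 4 4" and KJK: "transpose_mat K * spin_flip * K = spin_flip"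
    using assms by (auto simp: spin_flip_isometry_def)
  have [simp]: "dim_row K = 4" "dim_col K = 4" "dim_row X = 4" "dim_col X = 4"
    using carrier_matD[OF K] carrier_matD[OF X] by simp_all
  note [simp] = X and assoc = assoc_mult_mat[of _ 4 4 _ 4 _ 4]
  show "K * (X * mat_adjoint X) * mat_adjoint K = (K * X) * mat_adjoint (K * X)"
    by (simp add: mat_adjoint_mult assoc)
  have "transpose_mat (K * X) * spin_flip * (K * X) =
      transpose_mat X * (transpose_mat K * spin_flip * K) * X"
    by (simp add: transpose_mult[OF K X] assoc)
  then show "concurrence_of_factor (K * X) = concurrence_of_factor X"
    by (simp add: concurrence_of_factor_def KJK spin_flip_def[symmetric])
qed

text \<open>Multiplication by \<open>K\<close> and by its inverse exchanges the factors of the two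
  matrices, so both definite descriptions have equivalent predicates.\<close>

lemma concurrence_congruence:
  assumes K: "spin_flip_isometry K" and \<rho>: "\<rho> \<in> carrier_mat 4 4"
  shows "concurrence (K * \<rho> * mat_adjoint K) = concurrence \<rho>"
proof -
  obtain L where L: "spin_flip_isometry L" and LK: "L * K = 1\<^sub>m 4" and KL: "K * L = 1\<^sub>m 4"
    using spin_flip_isometry_inverse[OF K] .
  have carr[simp]: "K \<in> carrier_mat 4 4" "L \<in> carrier_mat 4 4"
    using K L by (auto simp: spin_flip_isometry_def)
  have [simp]: "dim_row K = 4" "dim_col K = 4" "dim_row L = 4" "dim_col L = 4"
    using carr[THEN carrier_matD(1)] carr[THEN carrier_matD(2)] by simp_all
  note [simp] = \<rho>
  have LKL: "L * (K * \<rho> * mat_adjoint K) * mat_adjoint L = \<rho>"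
    by (rule congruence_cancel[OF carr \<rho> LK])
  have "(\<exists>X \<in> carrier_mat 4 4. K * \<rho> * mat_adjoint K = X * mat_adjoint X \<and> c = concurrence_of_factor X)
    \<longleftrightarrow> (\<exists>X \<in> carrier_mat 4 4. \<rho> = X * mat_adjoint X \<and> c = concurrence_of_factor X)" for c
  proof (intro iffI; elim bexE conjE)
    fix X assume X: "X \<in> carrier_mat 4 4" "K * \<rho> * mat_adjoint K = X * mat_adjoint X"
      "c = concurrence_of_factor X"
    show "\<exists>X \<in> carrier_mat 4 4. \<rho> = X * mat_adjoint X \<and> c = concurrence_of_factor X"
      using factor_congruence[OF L X(1)] LKL X by (intro bexI[of _ "L * X"]) simp_all
  next
    fix X assume X: "X \<in> carrier_mat 4 4" "\<rho> = X * mat_adjoint X" "c = concurrence_of_factor X"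
    show "\<exists>X \<in> carrier_mat 4 4. K * \<rho> * mat_adjoint K = X * mat_adjoint X \<and> c = concurrence_of_factor X"
      using factor_congruence[OF K X(1)] X by (intro bexI[of _ "K * X"]) simp_all
  qed
  then show ?thesis by (simp add: concurrence_def)
qed

text \<open>Moving the leading \<open>mat_adjoint X\<close> to the end of the product keeps the
  characteristic polynomial and leaves an expression in \<open>\<rho>\<close> alone. Hence the
  singular values do not depend on the factor.\<close>

lemma char_poly_factor:
  assumes X: "X \<in> carrier_mat 4 4" and "\<rho> = X * mat_adjoint X"
  defines "Y \<equiv> transpose_mat X * spin_flip * X"
  shows "char_poly (mat_adjoint Y * Y) =
    char_poly (spin_flip * transpose_mat \<rho> * spin_flip * \<rho>)"
proof -
  have [simp]: "dim_row X = 4" "dim_col X = 4" using X by auto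
  note [simp] = X and assoc = assoc_mult_mat[of _ 4 4 _ 4 _ 4]
  define A where "A = spin_flip * mat_adjoint (transpose_mat X) * transpose_mat X * spin_flip * X"
  have A: "A \<in> carrier_mat 4 4" by (simp add: A_def)
  have "mat_adjoint Y * Y = mat_adjoint X * A"
    by (simp add: Y_def A_def mat_adjoint_mult spin_flip_hermitian assoc)
  also have "char_poly \<dots> = char_poly (A * mat_adjoint X)"
    by (rule char_poly_mult_commute[OF _ A]) simp
  also have "A * mat_adjoint X = spin_flip * transpose_mat \<rho> * spin_flip * \<rho>"
    using transpose_mult[of X 4 4 "mat_adjoint X" 4]
    by (simp add: A_def assms(2) transpose_adjoint assoc)
  finally show ?thesis .
qed

text \<open>The largest value minus the other three is twice the largest minus the total, so the
  order of the four values need not be known.\<close>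

lemma max_of_sorted:
  fixes a b c d :: real
  defines "\<tau> \<equiv> rev (sorted_list_of_multiset {#a, b, c, d#})"
  shows "\<tau> ! 0 - \<tau> ! 1 - \<tau> ! 2 - \<tau> ! 3 = 2 * max (max a b) (max c d) - (a + b + c + d)"
  by (simp add: \<tau>_def max_def)

text \<open>The given \<open>X\<close> supplies existence, and by \<open>char_poly_factor\<close>
  every factor yields the same value. Nonnegativity lets the square roots of the eigenvalues recover
  \<open>a\<close>, \<open>b\<close>, \<open>c\<close>, \<open>d\<close>.\<close>

lemma concurrence_eqI:
  assumes "X \<in> carrier_mat 4 4" "\<rho> = X * mat_adjoint X"
    and cp: "char_poly (spin_flip * transpose_mat \<rho> * spin_flip * \<rho>) =
      [:- of_real (a\<^sup>2), 1:] * [:- of_real (b\<^sup>2), 1:] * [:- of_real (c\<^sup>2), 1:] * [:- of_real (d\<^sup>2), 1:]"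
    and nonneg: "a \<ge> 0" "b \<ge> 0" "c \<ge> 0" "d \<ge> 0"
  shows "concurrence \<rho> = max 0 (2 * max (max a b) (max c d) - (a + b + c + d))"
proof -
  have *: "concurrence_of_factor Z = max 0 (2 * max (max a b) (max c d) - (a + b + c + d))"
    if "Z \<in> carrier_mat 4 4" "\<rho> = Z * mat_adjoint Z" for Z
  proof -
    have "singular_values (transpose_mat Z * spin_flip * Z) =
        rev (sorted_list_of_multiset {#a, b, c, d#})"
      unfolding singular_values_def char_poly_factor[OF that] cp
      using nonneg by (simp add: proots_mult del: mult_pCons_left mult_pCons_right of_real_power)
    then show ?thesis
      unfolding concurrence_of_factor_def spin_flip_def[symmetric] Let_def
      by (simp only: max_of_sorted)
  qed
  show ?thesis
    unfolding concurrence_def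
    by (rule the_equality) (use * assms(1,2) in auto)
qed

text \<open>The formulas also cover \<open>p = 0\<close>, where \<open>d = 0\<close> and \<open>d / 0 = 0\<close>.\<close>
lemma real_cholesky:
  fixes p q d :: real
  assumes "0 \<le> p" "0 \<le> q" "d\<^sup>2 \<le> p * q"
  shows "sqrt p * sqrt p = p" "sqrt p * (d / sqrt p) = d"
    "(d / sqrt p) * (d / sqrt p) + sqrt (q - d\<^sup>2 / p) * sqrt (q - d\<^sup>2 / p) = q"
proof -
  show "sqrt p * sqrt p = p" using assms by simp
  show "sqrt p * (d / sqrt p) = d" using assms by auto
  have "d\<^sup>2 / p \<le> q" using assms by (cases "p = 0") (auto simp: divide_simps mult.commute)
  then show "(d / sqrt p) * (d / sqrt p) + sqrt (q - d\<^sup>2 / p) * sqrt (q - d\<^sup>2 / p) = q"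
    using assms by (auto simp: power2_eq_square)
qed

text \<open>A difference of two squares: a block with both diagonal entries \<open>m\<close> and
  off-diagonal product \<open>w * w\<close> has eigenvalues \<open>m + w\<close> and
  \<open>m - w\<close>.\<close>

lemma linear_factors_of_square:
  fixes m w :: "'a::comm_ring_1"
  shows "[:-m, 1:] * [:-m, 1:] - [:w * w:] = [:-(m + w), 1:] * [:-(m - w), 1:]"
  by (simp add: algebra_simps)

text \<open>With \<open>g = sqrt (p * q)\<close> and \<open>h = sqrt (r * s)\<close> the singular
  values are \<open>g + d\<close>, \<open>g - d\<close>, \<open>h + e\<close>, \<open>h - e\<close>,
  of total \<open>2 * g + 2 * h\<close>. The largest is \<open>g + \<bar>d\<bar>\<close> or
  \<open>h + \<bar>e\<bar>\<close>, which produces the two entries of the maximum.\<close>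

lemma concurrence_x_state:
  fixes p q r s d e :: real
  assumes pq: "0 \<le> p" "0 \<le> q" "d\<^sup>2 \<le> p * q"
    and rs: "0 \<le> r" "0 \<le> s" "e\<^sup>2 \<le> r * s"
  shows "concurrence (x_mat (of_real p) (of_real d) (of_real r) (of_real e)
      (of_real e) (of_real s) (of_real d) (of_real q)) =
    max 0 (2 * max (\<bar>d\<bar> - sqrt (r * s)) (\<bar>e\<bar> - sqrt (p * q)))"
proof -
  define \<rho> where "\<rho> = x_mat (complex_of_real p) (of_real d) (of_real r) (of_real e)
      (of_real e) (of_real s) (of_real d) (of_real q)"
  \<comment> \<open>The lower triangular Cholesky factor of each block.\<close>
  define X where "X = x_mat (complex_of_real (sqrt p)) 0 (of_real (sqrt r)) 0
    (of_real (e / sqrt r)) (of_real (sqrt (s - e\<^sup>2 / r)))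
    (of_real (d / sqrt p)) (of_real (sqrt (q - d\<^sup>2 / p)))"
  have X: "X \<in> carrier_mat 4 4" by (simp add: X_def)
  have fac: "\<rho> = X * mat_adjoint X"
    unfolding X_def \<rho>_def adjoint_x_mat x_mat_mult complex_cnj_complex_of_real
      of_real_mult[symmetric] of_real_add[symmetric] complex_cnj_zero mult_zero_left mult_zero_right
      add_0_left add_0_right real_cholesky[OF pq] real_cholesky[OF rs]
      mult.commute[of "d / sqrt p" "sqrt p"] mult.commute[of "e / sqrt r" "sqrt r"] ..
  define g h where "g = sqrt (p * q)" and "h = sqrt (r * s)"
  have g: "g\<^sup>2 = p * q" "\<bar>d\<bar> \<le> g" and h: "h\<^sup>2 = r * s" "\<bar>e\<bar> \<le> h"
    using pq rs by (auto simp: g_def h_def intro: real_le_rsqrt)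
  \<comment> \<open>Conjugation by \<open>spin_flip\<close> exchanges the diagonal entries within
    each block, \<open>p\<close> with \<open>q\<close> and \<open>r\<close> with
    \<open>s\<close>.\<close>
  have "spin_flip * transpose_mat \<rho> * spin_flip * \<rho> =
      x_mat (of_real (p * q + d\<^sup>2)) (of_real (2 * d * q)) (of_real (r * s + e\<^sup>2)) (of_real (2 * e * s))
        (of_real (2 * e * r)) (of_real (r * s + e\<^sup>2)) (of_real (2 * d * p)) (of_real (p * q + d\<^sup>2))"
    unfolding \<rho>_def spin_flip_x_mat transpose_x_mat x_mat_mult
    by (rule x_mat_eqI) (simp_all add: power2_eq_square algebra_simps)
  also have "char_poly \<dots> =
      ([:- of_real (p * q + d\<^sup>2), 1:] * [:- of_real (p * q + d\<^sup>2), 1:]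
         - [:of_real (2 * d * g) * of_real (2 * d * g):]) *
      ([:- of_real (r * s + e\<^sup>2), 1:] * [:- of_real (r * s + e\<^sup>2), 1:]
         - [:of_real (2 * e * h) * of_real (2 * e * h):])"
  proof -
    have "(2 * d * q) * (2 * d * p) = (2 * d * g) * (2 * d * g)"
      using g(1) by (simp add: power2_eq_square)
    moreover have "(2 * e * s) * (2 * e * r) = (2 * e * h) * (2 * e * h)"
      using h(1) by (simp add: power2_eq_square)
    ultimately show ?thesis
      unfolding char_poly_x_mat by (simp only: of_real_mult[symmetric])
  qed
  also have "\<dots> = [:- of_real ((g + d)\<^sup>2), 1:] * [:- of_real ((g - d)\<^sup>2), 1:] *
      [:- of_real ((h + e)\<^sup>2), 1:] * [:- of_real ((h - e)\<^sup>2), 1:]"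
  proof -
    have "(g + d)\<^sup>2 = p * q + d\<^sup>2 + 2 * d * g" "(g - d)\<^sup>2 = p * q + d\<^sup>2 - 2 * d * g"
      "(h + e)\<^sup>2 = r * s + e\<^sup>2 + 2 * e * h" "(h - e)\<^sup>2 = r * s + e\<^sup>2 - 2 * e * h"
      using g(1) h(1) by (simp_all add: power2_sum power2_diff)
    then show ?thesis
      unfolding linear_factors_of_square by (simp only: of_real_add of_real_diff mult.assoc)
  qed
  finally have "concurrence \<rho> =
      max 0 (2 * max (max (g + d) (g - d)) (max (h + e) (h - e)) - (g + d + (g - d) + (h + e) + (h - e)))"
    using g(2) h(2) by (intro concurrence_eqI[OF X fac]) auto
  also have "\<dots> = max 0 (2 * max (\<bar>d\<bar> - h) (\<bar>e\<bar> - g))"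
    by (auto simp: max_def abs_if)
  finally show ?thesis by (simp add: \<rho>_def g_def h_def)
qed

lemma nonneg_binary_form:
  fixes p q d :: real
  assumes "\<And>x y. 0 \<le> p * x\<^sup>2 + 2 * d * x * y + q * y\<^sup>2"
  shows "0 \<le> p" "0 \<le> q" "d\<^sup>2 \<le> p * q"
proof -
  show p: "0 \<le> p" using assms[of 1 0] by simp
  show "0 \<le> q" using assms[of 0 1] by simp
  show "d\<^sup>2 \<le> p * q"
  proof (cases "p = 0")
    case True
    have "d = 0"
    proof (rule ccontr)
      assume "d \<noteq> 0"
      \<comment> \<open>At this point with \<open>p = 0\<close> the form takes the value -1.\<close>
      then show False using assms[of "- (q + 1) / (2 * d)" 1] True by simp
    qed
    then show ?thesis using True by simp
  next
    case False
    \<comment> \<open>The form at \<open>(- d, p)\<close> is \<open>p\<close> times the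
      determinant.\<close>
    have "0 \<le> p * (p * q - d\<^sup>2)"
      using assms[of "- d" p] by (simp add: power2_eq_square algebra_simps)
    then show ?thesis using p False by (simp add: zero_le_mult_iff)
  qed
qed

text \<open>Real test vectors supported on indices {0, 3} or {1, 2} give one binary quadratic form
  for each block.\<close>

lemma positive_semidefinite_x_matD:
  fixes p q r s d e :: real
  assumes "positive_semidefinite 4 (x_mat (of_real p) (of_real d) (of_real r) (of_real e)
      (of_real e) (of_real s) (of_real d) (of_real q))" (is "positive_semidefinite 4 ?\<rho>")
  shows "0 \<le> p" "0 \<le> q" "d\<^sup>2 \<le> p * q" "0 \<le> r" "0 \<le> s" "e\<^sup>2 \<le> r * s"
proof -
  have pos: "0 \<le> (?\<rho> *\<^sub>v v) \<bullet>c v" if "v \<in> carrier_vec 4" for v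
    using assms that by (simp add: positive_semidefinite_def)
  have "0 \<le> p * x\<^sup>2 + 2 * d * x * y + q * y\<^sup>2" for x y
  proof -
    let ?v = "vec 4 (\<lambda>i. complex_of_real ([x, 0, 0, y] ! i))"
    have "(?\<rho> *\<^sub>v ?v) \<bullet>c ?v = of_real (p * x\<^sup>2 + 2 * d * x * y + q * y\<^sup>2)"
      by (simp add: scalar_prod_def sum_4 power2_eq_square algebra_simps)
    then show ?thesis using pos[of ?v] by (simp add: less_eq_complex_def)
  qed
  from nonneg_binary_form[OF this] show "0 \<le> p" "0 \<le> q" "d\<^sup>2 \<le> p * q" .
  have "0 \<le> r * x\<^sup>2 + 2 * e * x * y + s * y\<^sup>2" for x y
  proof -
    let ?v = "vec 4 (\<lambda>i. complex_of_real ([0, x, y, 0] ! i))"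
    have "(?\<rho> *\<^sub>v ?v) \<bullet>c ?v = of_real (r * x\<^sup>2 + 2 * e * x * y + s * y\<^sup>2)"
      by (simp add: scalar_prod_def sum_4 power2_eq_square algebra_simps)
    then show ?thesis using pos[of ?v] by (simp add: less_eq_complex_def)
  qed
  from nonneg_binary_form[OF this] show "0 \<le> r" "0 \<le> s" "e\<^sup>2 \<le> r * s" .
qed

section \<open>Spinors of Lorentz transformations\<close>

text \<open>The usual identification of real four-vectors with Hermitian matrices of order two; the
  determinant becomes the Minkowski form.\<close>

definition pauli_comb :: "(nat \<Rightarrow> real) \<Rightarrow> complex mat" where
  "pauli_comb x = mat 2 2 (\<lambda>(a, b). \<Sum>k<4. of_real (x k) * pauli k $$ (a, b))"

text \<open>Says that \<open>A\<close> lies over \<open>L\<close> in the double cover of the Lorentz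
  group by SL(2,C), checked on the basis vectors, whose images are the columns of
  \<open>L\<close>.\<close>

definition spinor_of :: "real mat \<Rightarrow> complex mat \<Rightarrow> bool" where
  "spinor_of L A \<longleftrightarrow> L \<in> carrier_mat 4 4 \<and> A \<in> carrier_mat 2 2 \<and> det A = 1 \<and>
     (\<forall>i<4. A * pauli i * mat_adjoint A = pauli_comb (\<lambda>k. L $$ (k, i)))"

lemma pauli_comb_carrier[simp]: "pauli_comb x \<in> carrier_mat 2 2"
  by (simp add: pauli_comb_def)

lemma pauli_comb_dim[simp]: "dim_row (pauli_comb x) = 2" "dim_col (pauli_comb x) = 2"
  by (simp_all add: pauli_comb_def)

lemma index_pauli_comb:
  "a < 2 \<Longrightarrow> b < 2 \<Longrightarrow> pauli_comb x $$ (a, b) = (\<Sum>k<4. of_real (x k) * pauli k $$ (a, b))"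
  by (simp add: pauli_comb_def)

lemma index_congruence_2:
  assumes "A \<in> carrier_mat 2 2" "H \<in> carrier_mat 2 2" "a < 2" "b < 2"
  shows "(A * H * mat_adjoint A) $$ (a, b) =
    (A $$ (a,0) * H $$ (0,0) + A $$ (a,1) * H $$ (1,0)) * cnj (A $$ (b,0)) +
    (A $$ (a,0) * H $$ (0,1) + A $$ (a,1) * H $$ (1,1)) * cnj (A $$ (b,1))"
  using assms carrier_matD[OF assms(1)]
  by (simp add: index_mult_2 algebra_simps del: index_mult_mat(1))

lemma congruence_pauli_comb:
  assumes A: "A \<in> carrier_mat 2 2" and "a < 2" "b < 2"
  shows "(A * pauli_comb x * mat_adjoint A) $$ (a, b) =
    (\<Sum>k<4. of_real (x k) * (A * pauli k * mat_adjoint A) $$ (a, b))"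
  using assms
  by (simp add: index_congruence_2 index_pauli_comb lessThan_4 algebra_simps del: index_mult_mat(1))

text \<open>Acting with \<open>B\<close> expands the basis vector along a column of
  \<open>M\<close>; acting with \<open>A\<close> on each term then yields columns of
  \<open>L\<close>, by linearity.\<close>

lemma spinor_of_mult:
  assumes LA: "spinor_of L A" and MB: "spinor_of M B"
  shows "spinor_of (L * M) (A * B)"
proof -
  have [simp]: "L \<in> carrier_mat 4 4" "M \<in> carrier_mat 4 4"
    and A[simp]: "A \<in> carrier_mat 2 2" and B[simp]: "B \<in> carrier_mat 2 2"
    using assms by (auto simp: spinor_of_def)
  have [simp]: "dim_row A = 2" "dim_col A = 2" "dim_row B = 2" "dim_col B = 2"
    using carrier_matD[OF A] carrier_matD[OF B] by simp_all
  have "(A * B) * pauli i * mat_adjoint (A * B) = pauli_comb (\<lambda>k. (L * M) $$ (k, i))"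
    if i: "i < 4" for i
  proof -
    note [simp] = i
    have "(A * B) * pauli i * mat_adjoint (A * B) = A * (B * pauli i * mat_adjoint B) * mat_adjoint A"
      by (simp add: mat_adjoint_mult assoc_mult_mat[of _ 2 2 _ 2 _ 2])
    also have "\<dots> = A * pauli_comb (\<lambda>k. M $$ (k, i)) * mat_adjoint A"
      using MB i by (simp add: spinor_of_def)
    also have "\<dots> = pauli_comb (\<lambda>k. (L * M) $$ (k, i))"
    proof (rule eq_matI)
      fix a b assume "a < dim_row (pauli_comb (\<lambda>k. (L * M) $$ (k, i)))"
        "b < dim_col (pauli_comb (\<lambda>k. (L * M) $$ (k, i)))"
      then have ab[simp]: "a < 2" "b < 2" by auto
      have "(A * pauli_comb (\<lambda>k. M $$ (k, i)) * mat_adjoint A) $$ (a, b) =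
          (\<Sum>k<4. of_real (M $$ (k, i)) * pauli_comb (\<lambda>l. L $$ (l, k)) $$ (a, b))"
        unfolding congruence_pauli_comb[OF A ab]
        by (rule sum.cong) (use LA in \<open>simp_all add: spinor_of_def del: index_mult_mat(1)\<close>)
      also have "\<dots> = pauli_comb (\<lambda>k. (L * M) $$ (k, i)) $$ (a, b)"
        by (simp add: index_pauli_comb lessThan_4 index_mult_4 algebra_simps del: index_mult_mat(1))
      finally show "(A * pauli_comb (\<lambda>k. M $$ (k, i)) * mat_adjoint A) $$ (a, b) =
          pauli_comb (\<lambda>k. (L * M) $$ (k, i)) $$ (a, b)" .
    qed simp_all
    finally show ?thesis .
  qed
  then show ?thesis
    using assms by (simp add: spinor_of_def det_mult[OF A B])
qed

section \<open>Elementary rotations and boosts with their spinors\<close>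

definition rotation23 :: "real \<Rightarrow> real \<Rightarrow> real mat" where
  "rotation23 c s = mat_of_rows_list 4
     [[1, 0, 0, 0],
      [0, 1, 0, 0],
      [0, 0, c, - s],
      [0, 0, s, c]]"

lemma rotation23_dim[simp]: "dim_row (rotation23 c s) = 4" "dim_col (rotation23 c s) = 4"
  by (simp_all add: rotation23_def mat_of_rows_list_def)

lemma rotation23_carrier[simp]: "rotation23 c s \<in> carrier_mat 4 4"
  by (rule carrier_matI) simp_all

lemma index_rotation23[simp]:
  "rotation23 c s $$ (0, 0) = 1" "rotation23 c s $$ (0, Suc 0) = 0" "rotation23 c s $$ (0, 2) = 0" "rotation23 c s $$ (0, 3) = 0"
  "rotation23 c s $$ (Suc 0, 0) = 0" "rotation23 c s $$ (Suc 0, Suc 0) = 1" "rotation23 c s $$ (Suc 0, 2) = 0" "rotation23 c s $$ (Suc 0, 3) = 0"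
  "rotation23 c s $$ (2, 0) = 0" "rotation23 c s $$ (2, Suc 0) = 0" "rotation23 c s $$ (2, 2) = c" "rotation23 c s $$ (2, 3) = - s"
  "rotation23 c s $$ (3, 0) = 0" "rotation23 c s $$ (3, Suc 0) = 0" "rotation23 c s $$ (3, 2) = s" "rotation23 c s $$ (3, 3) = c"
  by (simp_all add: rotation23_def mat_of_rows_list_def)

text \<open>Unlike \<open>rotation23\<close>, this rotation and the boost have the shape of
  \<open>x_mat\<close>. The parameters stand for cosine and sine, hyperbolic for the boost, so that
  no angle or rapidity has to be chosen.\<close>

abbreviation rotation12 :: "real \<Rightarrow> real \<Rightarrow> real mat" where
  "rotation12 c s \<equiv> x_mat 1 0 c (- s) s c 0 1"

abbreviation boost03 :: "real \<Rightarrow> real \<Rightarrow> real mat" where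
  "boost03 c s \<equiv> x_mat c s 1 0 0 1 s c"

definition mat2 :: "complex \<Rightarrow> complex \<Rightarrow> complex \<Rightarrow> complex \<Rightarrow> complex mat" where
  "mat2 a b c d = mat_of_rows_list 2 [[a, b], [c, d]]"

lemma mat2_dim[simp]: "dim_row (mat2 a b c d) = 2" "dim_col (mat2 a b c d) = 2"
  by (simp_all add: mat2_def mat_of_rows_list_def)

lemma mat2_carrier[simp]: "mat2 a b c d \<in> carrier_mat 2 2"
  by (rule carrier_matI) simp_all

lemma index_mat2[simp]:
  "mat2 a b c d $$ (0, 0) = a" "mat2 a b c d $$ (0, Suc 0) = b"
  "mat2 a b c d $$ (Suc 0, 0) = c" "mat2 a b c d $$ (Suc 0, Suc 0) = d"
  by (simp_all add: mat2_def mat_of_rows_list_def)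

lemma spinor_ofI:
  assumes L: "L \<in> carrier_mat 4 4" and "a * d - b * c = 1"
    and "\<And>i. i < 4 \<Longrightarrow> mat2 a b c d * pauli i * mat_adjoint (mat2 a b c d) = pauli_comb (\<lambda>k. L $$ (k, i))"
  shows "spinor_of L (mat2 a b c d)"
  using assms by (simp add: spinor_of_def det_2)

text \<open>Half-angle formulas: \<open>u + i v\<close> is a complex square root of
  \<open>c + i s\<close>.\<close>

lemma unit_square_root:
  fixes c s :: real
  assumes "c\<^sup>2 + s\<^sup>2 = 1"
  obtains u v :: real where "u\<^sup>2 + v\<^sup>2 = 1" "u\<^sup>2 - v\<^sup>2 = c" "2 * u * v = s"
proof -
  define z where "z = csqrt (Complex c s)"
  have z2: "z\<^sup>2 = Complex c s" by (simp add: z_def)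
  have "(norm z)\<^sup>2 = norm (z\<^sup>2)" by (simp only: norm_power)
  then have "(norm z)\<^sup>2 = 1" using assms by (simp add: z2 cmod_def)
  then have "(Re z)\<^sup>2 + (Im z)\<^sup>2 = 1" by (simp only: cmod_power2)
  moreover have "(Re z)\<^sup>2 - (Im z)\<^sup>2 = c" "2 * Re z * Im z = s"
    using arg_cong[OF z2, of Re] arg_cong[OF z2, of Im]
    by (simp_all only: complex.sel Re_power2 Im_power2)
  ultimately show ?thesis by (rule that)
qed

lemma spinor_of_rotation12:
  assumes "c\<^sup>2 + s\<^sup>2 = 1"
  shows "\<exists>A. spinor_of (rotation12 c s) A"
proof -
  obtain u v where uv: "u\<^sup>2 + v\<^sup>2 = 1" "u\<^sup>2 - v\<^sup>2 = c" "2 * u * v = s"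
    using unit_square_root[OF assms] .
  \<comment> \<open>The diagonal matrix of the phases with angles minus and plus half the rotation
    angle.\<close>
  have "spinor_of (rotation12 c s) (mat2 (Complex u (- v)) 0 0 (Complex u v))"
  proof (rule spinor_ofI)
    fix i :: nat assume "i < 4"
    then show "mat2 (Complex u (- v)) 0 0 (Complex u v) * pauli i *
        mat_adjoint (mat2 (Complex u (- v)) 0 0 (Complex u v)) =
        pauli_comb (\<lambda>k. rotation12 c s $$ (k, i))"
      using uv
      by (elim less_4_cases; intro eq_mat_2I)
        (simp_all add: index_congruence_2 index_pauli_comb lessThan_4 complex_eq_iff
          power2_eq_square algebra_simps del: index_mult_mat(1))
  qed (use uv in \<open>simp_all add: complex_eq_iff power2_eq_square\<close>)
  then show ?thesis ..
qed

lemma spinor_of_rotation23: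
  assumes "c\<^sup>2 + s\<^sup>2 = 1"
  shows "\<exists>A. spinor_of (rotation23 c s) A"
proof -
  obtain u v where uv: "u\<^sup>2 + v\<^sup>2 = 1" "u\<^sup>2 - v\<^sup>2 = c" "2 * u * v = s"
    using unit_square_root[OF assms] .
  \<comment> \<open>This is \<open>u\<close> times the identity minus \<open>i v\<close> times
    \<open>pauli 1\<close>, a rotation about axis 1.\<close>
  let ?A = "mat2 (of_real u) (Complex 0 (- v)) (Complex 0 (- v)) (of_real u)"
  have "spinor_of (rotation23 c s) ?A"
  proof (rule spinor_ofI)
    fix i :: nat assume "i < 4"
    then show "?A * pauli i * mat_adjoint ?A = pauli_comb (\<lambda>k. rotation23 c s $$ (k, i))"
      using uv
      by (elim less_4_cases; intro eq_mat_2I)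
        (simp_all add: index_congruence_2 index_pauli_comb lessThan_4 complex_eq_iff
          power2_eq_square algebra_simps del: index_mult_mat(1))
  qed (use uv in \<open>simp_all add: complex_eq_iff power2_eq_square\<close>)
  then show ?thesis ..
qed

lemma spinor_of_boost03:
  assumes "c\<^sup>2 - s\<^sup>2 = 1" "c > 0"
  shows "\<exists>A. spinor_of (boost03 c s) A"
proof -
  have "(c + s) * (c - s) = 1" using assms by (simp add: power2_eq_square algebra_simps)
  \<comment> \<open>The factors have product 1 and sum \<open>2 * c > 0\<close>, so both are
    positive.\<close>
  moreover have "0 < c + s \<or> 0 < c - s" using assms(2) by linarith
  ultimately have pos: "0 < c + s" by (smt (verit) zero_less_mult_iff)
  have inv: "1 / (c + s) = c - s"
    using pos \<open>(c + s) * (c - s) = 1\<close> by (simp add: field_simps)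
  \<comment> \<open>Here \<open>c + s\<close> is the exponential of the rapidity; the spinor uses
    half the rapidity.\<close>
  define r where "r = sqrt (c + s)"
  have r: "r * r = c + s" "inverse r * inverse r = c - s" "r \<noteq> 0"
    using pos \<open>(c + s) * (c - s) = 1\<close>
    by (auto simp: r_def real_inv_sqrt_pow2 inverse_mult_distrib[symmetric] intro: inverse_unique
        simp del: inverse_mult_distrib)
  let ?A = "mat2 (of_real r) 0 0 (of_real (inverse r))"
  have "spinor_of (boost03 c s) ?A"
  proof (rule spinor_ofI)
    fix i :: nat assume "i < 4"
    then show "?A * pauli i * mat_adjoint ?A = pauli_comb (\<lambda>k. boost03 c s $$ (k, i))"
      using r inv pos
      by (elim less_4_cases; intro eq_mat_2I)
        (simp_all add: index_congruence_2 index_pauli_comb lessThan_4 complex_eq_iff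
          power2_eq_square algebra_simps del: index_mult_mat(1))
  qed (use r in \<open>simp_all add: complex_eq_iff power2_eq_square\<close>)
  then show ?thesis ..
qed

section \<open>The proper Lorentz group\<close>

lemma minkowski_x_mat: "minkowski = x_mat 1 0 (- 1) 0 0 (- 1) 0 (- 1)"
  by (simp add: minkowski_def x_mat_def)

text \<open>Time orientation is kept apart, so closure under products and transposition is purely
  algebraic.\<close>

definition lorentz :: "real mat \<Rightarrow> bool" where
  "lorentz L \<longleftrightarrow> L \<in> carrier_mat 4 4 \<and> L * minkowski * transpose_mat L = minkowski \<and> det L = 1"

lemma lorentz_mult:
  assumes "lorentz G" "lorentz L"
  shows "lorentz (G * L)"
proof -
  have G[simp]: "G \<in> carrier_mat 4 4" and L[simp]: "L \<in> carrier_mat 4 4"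
    using assms by (auto simp: lorentz_def)
  have [simp]: "minkowski \<in> carrier_mat 4 4" by (simp add: minkowski_x_mat)
  have "G * L * minkowski * transpose_mat (G * L) =
      G * (L * minkowski * transpose_mat L) * transpose_mat G"
    by (simp add: transpose_mult[OF G L] assoc_mult_mat[of _ 4 4 _ 4 _ 4])
  then show ?thesis
    using assms by (simp add: lorentz_def det_mult[OF G L])
qed

lemma lorentz_rows:
  assumes "lorentz L" "i < 4" "j < 4"
  shows "L $$ (i,0) * L $$ (j,0) - L $$ (i,1) * L $$ (j,1) - L $$ (i,2) * L $$ (j,2)
    - L $$ (i,3) * L $$ (j,3) = minkowski $$ (i,j)"
proof -
  have L[simp]: "L \<in> carrier_mat 4 4" and LML: "L * minkowski * transpose_mat L = minkowski"
    using assms by (auto simp: lorentz_def)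
  have "(L * minkowski * transpose_mat L) $$ (i,j) = L $$ (i,0) * L $$ (j,0)
      - L $$ (i,1) * L $$ (j,1) - L $$ (i,2) * L $$ (j,2) - L $$ (i,3) * L $$ (j,3)"
    using assms(2,3) carrier_matD[OF L]
    by (simp add: minkowski_x_mat index_mult_4 del: index_mult_mat(1))
  then show ?thesis by (simp add: LML)
qed

text \<open>The defining equation makes \<open>minkowski * transpose_mat L * minkowski\<close> a
  right inverse of \<open>L\<close>, hence a left inverse, which rearranges to the equation for the
  transpose.\<close>

lemma lorentz_transpose:
  assumes "lorentz L"
  shows "lorentz (transpose_mat L)"
proof -
  have L[simp]: "L \<in> carrier_mat 4 4" and LML: "L * minkowski * transpose_mat L = minkowski"
    using assms by (auto simp: lorentz_def)
  have M[simp]: "minkowski \<in> carrier_mat 4 4" by (simp add: minkowski_x_mat)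
  have MM: "minkowski * minkowski = 1\<^sub>m 4"
    by (simp add: minkowski_x_mat x_mat_mult one_mat_4)
  note assoc = assoc_mult_mat[of _ 4 4 _ 4 _ 4]
  let ?N = "minkowski * transpose_mat L * minkowski"
  have "L * ?N = (L * minkowski * transpose_mat L) * minkowski"
    by (simp add: assoc)
  then have "L * ?N = 1\<^sub>m 4" by (simp add: LML MM)
  then have "?N * L = 1\<^sub>m 4"
    by (rule mat_mult_left_right_inverse[rotated 2]) simp_all
  then have "minkowski * (?N * L) = minkowski" by (simp only: right_mult_one_mat[OF M])
  moreover have "minkowski * (?N * L) = (minkowski * minkowski) * (transpose_mat L * minkowski * L)"
    by (simp add: assoc)
  ultimately show ?thesis
    using assms by (simp add: lorentz_def MM det_transpose[OF L] left_mult_one_mat[of _ 4 4])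
qed

lemma lorentz_rotation12: "c\<^sup>2 + s\<^sup>2 = 1 \<Longrightarrow> lorentz (rotation12 c s)"
  by (auto simp: lorentz_def minkowski_x_mat x_mat_mult transpose_x_mat det_4 power2_eq_square
      algebra_simps intro!: x_mat_eqI)

lemma lorentz_boost03: "c\<^sup>2 - s\<^sup>2 = 1 \<Longrightarrow> lorentz (boost03 c s)"
  by (auto simp: lorentz_def minkowski_x_mat x_mat_mult transpose_x_mat det_4 power2_eq_square
      algebra_simps intro!: x_mat_eqI)

lemma lorentz_rotation23: "c\<^sup>2 + s\<^sup>2 = 1 \<Longrightarrow> lorentz (rotation23 c s)"
proof -
  assume cs: "c\<^sup>2 + s\<^sup>2 = 1"
  have "rotation23 c s * minkowski * transpose_mat (rotation23 c s) = minkowski"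
    by (rule eq_mat_4I)
      (use cs in \<open>simp_all add: minkowski_x_mat index_mult_4 power2_eq_square algebra_simps del: index_mult_mat(1)\<close>)
  then show ?thesis
    using cs by (simp add: lorentz_def det_4 power2_eq_square)
qed

text \<open>Turns \<open>(x, y)\<close> onto the nonnegative second axis: cosine and sine are
  \<open>y\<close> and \<open>x\<close> divided by the length, and the zero vector takes the
  identity.\<close>

lemma rotate_to_axis:
  fixes x y :: real
  obtains c s where "c\<^sup>2 + s\<^sup>2 = 1" "c * x - s * y = 0" "s * x + c * y \<ge> 0"
proof (cases "x\<^sup>2 + y\<^sup>2 = 0")
  case True
  then show ?thesis using that[of 1 0] by (simp add: sum_power2_eq_zero_iff)
next
  case False
  define n where "n = sqrt (x\<^sup>2 + y\<^sup>2)"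
  have "x\<^sup>2 + y\<^sup>2 > 0" using False by (simp add: less_le)
  then have n: "n > 0" "n\<^sup>2 = x\<^sup>2 + y\<^sup>2" by (auto simp: n_def)
  have "(y / n)\<^sup>2 + (x / n)\<^sup>2 = 1" using n False
    by (simp add: power_divide add_divide_distrib[symmetric] add.commute)
  moreover have "y / n * x - x / n * y = 0" by simp
  moreover have "x / n * x + y / n * y \<ge> 0" using n by simp
  ultimately show ?thesis by (rule that)
qed

text \<open>Undoes one reduction step, since \<open>L = H * (G * L)\<close> and spinors
  multiply.\<close>

lemma spinor_of_cancel:
  assumes "\<exists>A. spinor_of (G * L) A" "\<exists>B. spinor_of H B" "H * G = 1\<^sub>m 4"
    and L: "L \<in> carrier_mat 4 4" and G: "G \<in> carrier_mat 4 4"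
  shows "\<exists>A. spinor_of L A"
proof -
  obtain A B where A: "spinor_of (G * L) A" and B: "spinor_of H B" using assms by blast
  have H: "H \<in> carrier_mat 4 4" using B by (simp add: spinor_of_def)
  have "H * (G * L) = L"
    using assoc_mult_mat[OF H G L] assms(3) L by simp
  then show ?thesis using spinor_of_mult[OF B A] by auto
qed

lemma spinor_of_rotation12_cancel:
  assumes "c\<^sup>2 + s\<^sup>2 = 1" "\<exists>A. spinor_of (rotation12 c s * L) A" "L \<in> carrier_mat 4 4"
  shows "\<exists>A. spinor_of L A"
proof (rule spinor_of_cancel[OF assms(2)])
  show "\<exists>B. spinor_of (rotation12 c (- s)) B" using assms(1) by (intro spinor_of_rotation12) simp
  show "rotation12 c (- s) * rotation12 c s = 1\<^sub>m 4"
    using assms(1)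
    by (auto simp: x_mat_mult one_mat_4 power2_eq_square algebra_simps intro!: x_mat_eqI)
qed (use assms in auto)

lemma spinor_of_boost03_cancel:
  assumes "c\<^sup>2 - s\<^sup>2 = 1" "c > 0" "\<exists>A. spinor_of (boost03 c s * L) A" "L \<in> carrier_mat 4 4"
  shows "\<exists>A. spinor_of L A"
proof (rule spinor_of_cancel[OF assms(3)])
  show "\<exists>B. spinor_of (boost03 c (- s)) B" using assms(1,2) by (intro spinor_of_boost03) simp_all
  show "boost03 c (- s) * boost03 c s = 1\<^sub>m 4"
    using assms(1)
    by (auto simp: x_mat_mult one_mat_4 power2_eq_square algebra_simps intro!: x_mat_eqI)
qed (use assms in auto)

lemma spinor_of_rotation23_cancel:
  assumes "c\<^sup>2 + s\<^sup>2 = 1" "\<exists>A. spinor_of (rotation23 c s * L) A" "L \<in> carrier_mat 4 4"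
  shows "\<exists>A. spinor_of L A"
proof (rule spinor_of_cancel[OF assms(2)])
  show "\<exists>B. spinor_of (rotation23 c (- s)) B" using assms(1) by (intro spinor_of_rotation23) simp
  show "rotation23 c (- s) * rotation23 c s = 1\<^sub>m 4"
    by (rule eq_mat_4I) (use assms(1) in
      \<open>simp_all add: index_mult_4 power2_eq_square algebra_simps del: index_mult_mat(1)\<close>)
qed (use assms in auto)

lemma lorentz_carrier: "lorentz L \<Longrightarrow> L \<in> carrier_mat 4 4"
  by (simp add: lorentz_def)

lemma lorentz_columns:
  assumes "lorentz L" "i < 4" "j < 4"
  shows "L $$ (0,i) * L $$ (0,j) - L $$ (1,i) * L $$ (1,j) - L $$ (2,i) * L $$ (2,j)
    - L $$ (3,i) * L $$ (3,j) = minkowski $$ (i,j)"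
  using lorentz_rows[OF lorentz_transpose[OF assms(1)] assms(2,3)] assms(2,3)
    carrier_matD[OF lorentz_carrier[OF assms(1)]]
  by simp

text \<open>The other columns are Minkowski-orthogonal to the first one, which is the unit time
  vector.\<close>

lemma lorentz_fixes_e0D:
  assumes L: "lorentz L"
    and "L $$ (0,0) = 1" "L $$ (1,0) = 0" "L $$ (2,0) = 0" "L $$ (3,0) = 0"
  shows "L $$ (0,1) = 0" "L $$ (0,2) = 0" "L $$ (0,3) = 0"
  using lorentz_columns[OF L, of 0 1] lorentz_columns[OF L, of 0 2] lorentz_columns[OF L, of 0 3]
    assms by (simp_all add: minkowski_x_mat)

text \<open>Orthogonality leaves only the block on axes 1 and 2, an orthogonal matrix of determinant
  1, hence a plane rotation.\<close>

lemma spinor_of_lorentz_fixing_e0_e3: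
  assumes L: "lorentz L"
    and e0: "L $$ (0,0) = 1" "L $$ (1,0) = 0" "L $$ (2,0) = 0" "L $$ (3,0) = 0"
    and e3: "L $$ (1,3) = 0" "L $$ (2,3) = 0" "L $$ (3,3) = 1"
  shows "\<exists>A. spinor_of L A"
proof -
  have carr: "L \<in> carrier_mat 4 4" by (rule lorentz_carrier[OF L])
  note row0 = lorentz_fixes_e0D[OF L e0]
  have row3: "L $$ (3,1) = 0" "L $$ (3,2) = 0"
    using lorentz_columns[OF L, of 3 1] lorentz_columns[OF L, of 3 2] e3 row0
    by (simp_all add: minkowski_x_mat)
  define a b c d where "a = L $$ (1,1)" and "b = L $$ (1,2)" and "c = L $$ (2,1)" and "d = L $$ (2,2)"
  note defs = a_def b_def c_def d_def
  have eq: "L = x_mat 1 0 a b c d 0 1"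
    by (rule eq_mat_4I) (use carr e0 e3 row0 row3 in \<open>simp_all add: defs\<close>)
  have "det L = 1" using L by (simp add: lorentz_def)
  then have det: "a * d - b * c = 1" by (simp add: eq det_4 mult.commute)
  have orth: "a * a + c * c = 1" "b * b + d * d = 1"
    using lorentz_columns[OF L, of 1 1] lorentz_columns[OF L, of 2 2]
    by (simp_all add: eq minkowski_x_mat)
  \<comment> \<open>Unit columns and determinant 1 make this sum of squares
    \<open>1 + 1 - 2\<close>.\<close>
  have "(a - d)\<^sup>2 + (b + c)\<^sup>2 = (a * a + c * c) + (b * b + d * d) - 2 * (a * d - b * c)"
    by (simp add: power2_eq_square algebra_simps)
  also have "\<dots> = 0" by (simp only: orth det)
  finally have "a = d" "b = - c" by (simp_all add: sum_power2_eq_zero_iff)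
  then have "L = rotation12 a c" by (simp add: eq)
  then show ?thesis using spinor_of_rotation12[of a c] orth by (simp add: power2_eq_square)
qed

text \<open>Two plane rotations move the last column to a nonnegative multiple of the third spatial
  axis and keep the first column. Its norm forces the multiple to be 1.\<close>

lemma spinor_of_lorentz_fixing_e0:
  assumes L: "lorentz L"
    and e0: "L $$ (0,0) = 1" "L $$ (1,0) = 0" "L $$ (2,0) = 0" "L $$ (3,0) = 0"
  shows "\<exists>A. spinor_of L A"
proof -
  obtain c s where cs: "c\<^sup>2 + s\<^sup>2 = 1" "c * L $$ (1,3) - s * L $$ (2,3) = 0"
    using rotate_to_axis .
  define N where "N = rotation12 c s * L"
  have Lc[simp]: "L \<in> carrier_mat 4 4" by (rule lorentz_carrier[OF L])
  have N: "lorentz N" unfolding N_def by (rule lorentz_mult[OF lorentz_rotation12[OF cs(1)] L])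
  have N0: "N $$ (0,0) = 1" "N $$ (1,0) = 0" "N $$ (2,0) = 0" "N $$ (3,0) = 0" "N $$ (1,3) = 0"
    using e0 cs(2) by (simp_all add: N_def index_mult_4 del: index_mult_mat(1))
  obtain c' s' where cs': "c'\<^sup>2 + s'\<^sup>2 = 1" "c' * N $$ (2,3) - s' * N $$ (3,3) = 0"
      "s' * N $$ (2,3) + c' * N $$ (3,3) \<ge> 0"
    using rotate_to_axis .
  define P where "P = rotation23 c' s' * N"
  have Nc[simp]: "N \<in> carrier_mat 4 4" by (rule lorentz_carrier[OF N])
  have P: "lorentz P" unfolding P_def by (rule lorentz_mult[OF lorentz_rotation23[OF cs'(1)] N])
  have P0: "P $$ (0,0) = 1" "P $$ (1,0) = 0" "P $$ (2,0) = 0" "P $$ (3,0) = 0"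
    and P3: "P $$ (1,3) = 0" "P $$ (2,3) = 0" "P $$ (3,3) \<ge> 0"
    using N0 cs'(2,3) by (simp_all add: P_def index_mult_4 del: index_mult_mat(1))
  have "P $$ (3,3) * P $$ (3,3) = 1"
    using lorentz_columns[OF P, of 3 3] lorentz_fixes_e0D[OF P P0] P3
    by (simp add: minkowski_x_mat)
  then have "P $$ (3,3) = 1" using P3(3) by (auto simp: square_eq_1_iff)
  then have "\<exists>A. spinor_of P A" using spinor_of_lorentz_fixing_e0_e3[OF P P0] P3 by blast
  then have "\<exists>A. spinor_of N A"
    unfolding P_def by (rule spinor_of_rotation23_cancel[OF cs'(1)]) simp_all
  then show ?thesis
    unfolding N_def by (rule spinor_of_rotation12_cancel[OF cs(1)]) simp_all
qed

text \<open>Two plane rotations bring the first column to the form \<open>(t, 0, 0, z)\<close>, and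
  a boost sends that to the unit time vector. Time orientation enters as
  \<open>t > 0\<close>.\<close>

lemma spinor_of_lorentz:
  assumes L: "lorentz L" and pos: "L $$ (0,0) > 0"
  shows "\<exists>A. spinor_of L A"
proof -
  obtain c s where cs: "c\<^sup>2 + s\<^sup>2 = 1" "c * L $$ (1,0) - s * L $$ (2,0) = 0"
    using rotate_to_axis .
  define N where "N = rotation12 c s * L"
  have Lc[simp]: "L \<in> carrier_mat 4 4" by (rule lorentz_carrier[OF L])
  have N: "lorentz N" unfolding N_def by (rule lorentz_mult[OF lorentz_rotation12[OF cs(1)] L])
  have N0: "N $$ (0,0) > 0" "N $$ (1,0) = 0"
    using pos cs(2) by (simp_all add: N_def index_mult_4 del: index_mult_mat(1))
  obtain c' s' where cs': "c'\<^sup>2 + s'\<^sup>2 = 1" "c' * N $$ (2,0) - s' * N $$ (3,0) = 0"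
    using rotate_to_axis .
  define P where "P = rotation23 c' s' * N"
  have Nc[simp]: "N \<in> carrier_mat 4 4" by (rule lorentz_carrier[OF N])
  have P: "lorentz P" unfolding P_def by (rule lorentz_mult[OF lorentz_rotation23[OF cs'(1)] N])
  have P0: "P $$ (0,0) > 0" "P $$ (1,0) = 0" "P $$ (2,0) = 0"
    using N0 cs'(2) by (simp_all add: P_def index_mult_4 del: index_mult_mat(1))
  define t z where "t = P $$ (0,0)" and "z = P $$ (3,0)"
  have tz: "t\<^sup>2 - (- z)\<^sup>2 = 1" "t > 0"
    using lorentz_columns[OF P, of 0 0] P0 by (simp_all add: minkowski_x_mat t_def z_def power2_eq_square)
  \<comment> \<open>The boost built from the column itself: its time component becomes
    \<open>t * t - z * z = 1\<close>, and the third spatial one cancels.\<close>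
  define Q where "Q = boost03 t (- z) * P"
  have Pc[simp]: "P \<in> carrier_mat 4 4" by (rule lorentz_carrier[OF P])
  have Q: "lorentz Q" unfolding Q_def by (rule lorentz_mult[OF lorentz_boost03[OF tz(1)] P])
  have "Q $$ (0,0) = 1" "Q $$ (1,0) = 0" "Q $$ (2,0) = 0" "Q $$ (3,0) = 0"
    using P0 tz(1)
    by (simp_all add: Q_def index_mult_4 t_def[symmetric] z_def[symmetric] power2_eq_square
        del: index_mult_mat(1))
  then have "\<exists>A. spinor_of Q A" by (rule spinor_of_lorentz_fixing_e0[OF Q])
  then have "\<exists>A. spinor_of P A"
    unfolding Q_def by (rule spinor_of_boost03_cancel[OF tz]) simp_all
  then have "\<exists>A. spinor_of N A"
    unfolding P_def by (rule spinor_of_rotation23_cancel[OF cs'(1)]) simp_all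
  then show ?thesis
    unfolding N_def by (rule spinor_of_rotation12_cancel[OF cs(1)]) simp_all
qed

section \<open>Expansion in Pauli matrices\<close>

text \<open>The factor 1/4 reflects that each product of two Pauli matrices has square of trace 4.
  The single sum over pairs fits \<open>index_mult_linear\<close>.\<close>

definition pauli_expansion :: "real mat \<Rightarrow> complex mat" where
  "pauli_expansion S = mat 4 4 (\<lambda>(m, n).
     (\<Sum>(i, j)\<in>{..<4} \<times> {..<4}. of_real (S $$ (i, j) / 4) * (pauli i \<otimes>\<^sub>m pauli j) $$ (m, n)))"

lemma pauli_expansion_carrier[simp]: "pauli_expansion S \<in> carrier_mat 4 4"
  by (simp add: pauli_expansion_def)

lemma index_pauli_expansion:
  "m < 4 \<Longrightarrow> n < 4 \<Longrightarrow> pauli_expansion S $$ (m, n) =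
    (\<Sum>i<4. \<Sum>j<4. of_real (S $$ (i, j) / 4) * (pauli i \<otimes>\<^sub>m pauli j) $$ (m, n))"
  by (simp add: pauli_expansion_def sum.cartesian_product)

lemma index_pauli_kronecker:
  "i < 4 \<Longrightarrow> j < 4 \<Longrightarrow> m < 4 \<Longrightarrow> n < 4 \<Longrightarrow>
    (pauli i \<otimes>\<^sub>m pauli j) $$ (m, n) = pauli i $$ (m div 2, n div 2) * pauli j $$ (m mod 2, n mod 2)"
  by (simp add: index_kronecker pauli_dim)

lemma pauli_kronecker_carrier[simp]: "i < 4 \<Longrightarrow> j < 4 \<Longrightarrow> pauli i \<otimes>\<^sub>m pauli j \<in> carrier_mat 4 4"
  using kronecker_carrier[of "pauli i" 2 2 "pauli j" 2 2] by simp

text \<open>The sixteen products form a basis orthogonal for the trace form, so the traces determine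
  \<open>\<rho>\<close>.\<close>

lemma pauli_expansion_of_traces:
  assumes \<rho>: "\<rho> \<in> carrier_mat 4 4"
    and R: "\<And>i j. i < 4 \<Longrightarrow> j < 4 \<Longrightarrow>
      complex_of_real (R $$ (i, j)) = mat_trace (\<rho> * (pauli i \<otimes>\<^sub>m pauli j))"
  shows "\<rho> = pauli_expansion R"
proof -
  have "complex_of_real (R $$ (i, j)) = (\<Sum>m<4. \<Sum>n<4. \<rho> $$ (m, n) *
      (pauli i $$ (n div 2, m div 2) * pauli j $$ (n mod 2, m mod 2)))" if "i < 4" "j < 4" for i j
    using that \<rho> by (simp add: R mat_trace_mult_4 index_pauli_kronecker)
  then show ?thesis
    by (intro eq_mat_4I) (simp_all add: \<rho> index_pauli_expansion index_pauli_kronecker lessThan_4 field_simps)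
qed

lemma kronecker_congruence:
  assumes "A \<in> carrier_mat 2 2" "B \<in> carrier_mat 2 2" "i < 4" "j < 4"
  shows "(A \<otimes>\<^sub>m B) * (pauli i \<otimes>\<^sub>m pauli j) * mat_adjoint (A \<otimes>\<^sub>m B) =
    (A * pauli i * mat_adjoint A) \<otimes>\<^sub>m (B * pauli j * mat_adjoint B)"
  using assms carrier_matD[OF assms(1)] carrier_matD[OF assms(2)]
  by (simp add: adjoint_kronecker kronecker_mult pauli_dim)

text \<open>The congruence acts on each tensor factor separately, replacing \<open>pauli i\<close>
  by column \<open>i\<close> of \<open>L1\<close> and \<open>pauli j\<close> by column
  \<open>j\<close> of \<open>L2\<close>. Collecting coefficients gives the triple matrix
  product.\<close>

lemma pauli_expansion_congruence:
  assumes L1: "spinor_of L1 A" and L2: "spinor_of L2 B" and S: "S \<in> carrier_mat 4 4"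
  shows "pauli_expansion (L1 * S * transpose_mat L2) =
    (A \<otimes>\<^sub>m B) * pauli_expansion S * mat_adjoint (A \<otimes>\<^sub>m B)"
proof -
  have A: "A \<in> carrier_mat 2 2" and B: "B \<in> carrier_mat 2 2"
    and L1c: "L1 \<in> carrier_mat 4 4" and L2c: "L2 \<in> carrier_mat 4 4"
    using L1 L2 by (auto simp: spinor_of_def)
  have AB: "A \<otimes>\<^sub>m B \<in> carrier_mat 4 4" using kronecker_carrier[OF A B] by simp
  show ?thesis
  proof (rule eq_matI)
    fix m n
    assume "m < dim_row ((A \<otimes>\<^sub>m B) * pauli_expansion S * mat_adjoint (A \<otimes>\<^sub>m B))"
      "n < dim_col ((A \<otimes>\<^sub>m B) * pauli_expansion S * mat_adjoint (A \<otimes>\<^sub>m B))"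
    then have mn: "m < 4" "n < 4" using AB carrier_matD[OF AB] by auto
    then have mn2: "m div 2 < 2" "n div 2 < 2" "m mod 2 < 2" "n mod 2 < 2" by auto
    let ?f = "\<lambda>i. pauli_comb (\<lambda>k. L1 $$ (k, i)) $$ (m div 2, n div 2)"
    let ?g = "\<lambda>j. pauli_comb (\<lambda>k. L2 $$ (k, j)) $$ (m mod 2, n mod 2)"
    have "((A \<otimes>\<^sub>m B) * pauli_expansion S * mat_adjoint (A \<otimes>\<^sub>m B)) $$ (m, n) =
        (\<Sum>(i, j)\<in>{..<4} \<times> {..<4}. of_real (S $$ (i, j) / 4) *
          ((A \<otimes>\<^sub>m B) * (pauli i \<otimes>\<^sub>m pauli j) * mat_adjoint (A \<otimes>\<^sub>m B)) $$ (m, n))"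
      using index_mult_linear[of "A \<otimes>\<^sub>m B" 4 "mat_adjoint (A \<otimes>\<^sub>m B)" "{..<4} \<times> {..<4}"
          "\<lambda>(i, j). pauli i \<otimes>\<^sub>m pauli j" m n "\<lambda>(i, j). complex_of_real (S $$ (i, j) / 4)"] AB mn
      by (auto simp: pauli_expansion_def case_prod_beta simp del: index_mult_mat)
    also have "\<dots> = (\<Sum>i<4. \<Sum>j<4. of_real (S $$ (i, j) / 4) * (?f i * ?g j))"
      unfolding sum.cartesian_product[symmetric]
    proof (intro sum.cong refl, goal_cases)
      case (1 i j)
      then show ?case
        using L1 L2 mn by (simp add: kronecker_congruence[OF A B] spinor_of_def index_kronecker)
    qed
    also have "\<dots> = (\<Sum>i<4. \<Sum>j<4. of_real (S $$ (i, j) / 4) *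
        ((\<Sum>k<4. of_real (L1 $$ (k, i)) * pauli k $$ (m div 2, n div 2)) *
         (\<Sum>l<4. of_real (L2 $$ (l, j)) * pauli l $$ (m mod 2, n mod 2))))"
      using mn2 by (simp add: index_pauli_comb)
    also have "\<dots> = (\<Sum>k<4. \<Sum>l<4. of_real ((\<Sum>i<4. \<Sum>j<4. L1 $$ (k, i) * S $$ (i, j) * L2 $$ (l, j)) / 4) *
        (pauli k $$ (m div 2, n div 2) * pauli l $$ (m mod 2, n mod 2)))"
      (is "?l = ?r")
    proof -
      let ?h = "\<lambda>i j k l. complex_of_real (S $$ (i, j) / 4) *
        ((of_real (L1 $$ (k, i)) * pauli k $$ (m div 2, n div 2)) *
         (of_real (L2 $$ (l, j)) * pauli l $$ (m mod 2, n mod 2)))"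
      \<comment> \<open>The four sums are reordered so that the new Pauli indices \<open>k\<close>,
        \<open>l\<close> are outermost.\<close>
      have "?l = (\<Sum>i<4. \<Sum>j<4. \<Sum>k<4. \<Sum>l<4. ?h i j k l)"
        by (simp only: sum_product) (simp only: sum_distrib_left)
      also have "\<dots> = (\<Sum>i<4. \<Sum>k<4. \<Sum>j<4. \<Sum>l<4. ?h i j k l)"
        by (intro sum.cong refl sum.swap)
      also have "\<dots> = (\<Sum>k<4. \<Sum>i<4. \<Sum>j<4. \<Sum>l<4. ?h i j k l)"
        by (rule sum.swap)
      also have "\<dots> = (\<Sum>k<4. \<Sum>i<4. \<Sum>l<4. \<Sum>j<4. ?h i j k l)"
        by (intro sum.cong refl sum.swap)
      also have "\<dots> = (\<Sum>k<4. \<Sum>l<4. \<Sum>i<4. \<Sum>j<4. ?h i j k l)"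
        by (intro sum.cong refl sum.swap)
      also have "\<dots> = ?r"
        by (simp add: sum_distrib_left sum_distrib_right sum_divide_distrib mult_ac)
      finally show ?thesis .
    qed
    also have "\<dots> = pauli_expansion (L1 * S * transpose_mat L2) $$ (m, n)"
    proof -
      have "(L1 * S * transpose_mat L2) $$ (k, l) =
          (\<Sum>i<4. \<Sum>j<4. L1 $$ (k, i) * S $$ (i, j) * L2 $$ (l, j))" if "k < 4" "l < 4" for k l
        using that S L1c L2c carrier_matD[OF L2c]
        by (simp add: index_mult_4 lessThan_4 algebra_simps del: index_mult_mat(1))
      then show ?thesis
        using mn by (simp add: index_pauli_expansion index_pauli_kronecker)
    qed
    finally show "pauli_expansion (L1 * S * transpose_mat L2) $$ (m, n) =
        ((A \<otimes>\<^sub>m B) * pauli_expansion S * mat_adjoint (A \<otimes>\<^sub>m B)) $$ (m, n)" ..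
  qed (use carrier_matD[OF AB] in \<open>simp_all add: pauli_expansion_def\<close>)
qed

text \<open>\<open>pauli 2\<close> is a multiple of the standard alternating form, which
  \<open>A\<close> scales by its determinant.\<close>

lemma pauli_2_symplectic:
  assumes A: "A \<in> carrier_mat 2 2" and "det A = 1"
  shows "transpose_mat A * pauli 2 * A = pauli 2"
proof -
  have "A $$ (0, 0) * A $$ (1, 1) = 1 + A $$ (0, 1) * A $$ (1, 0)"
    using assms by (simp add: det_2 algebra_simps)
  then show ?thesis
    using A carrier_matD[OF A]
    by (intro eq_mat_2I) (simp_all add: index_mult_2 algebra_simps del: index_mult_mat(1))
qed

lemma spin_flip_isometry_kronecker:
  assumes A: "A \<in> carrier_mat 2 2" "det A = 1" and B: "B \<in> carrier_mat 2 2" "det B = 1"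
  shows "spin_flip_isometry (A \<otimes>\<^sub>m B)"
  using kronecker_carrier[OF A(1) B(1)] carrier_matD[OF A(1)] carrier_matD[OF B(1)]
  by (simp add: spin_flip_isometry_def spin_flip_def transpose_kronecker kronecker_mult pauli_dim
      pauli_2_symplectic[OF A] pauli_2_symplectic[OF B])

section \<open>Passage to the normal forms\<close>

lemma proper_orthochronous_lorentz_spinor:
  assumes "proper_orthochronous_lorentz L"
  obtains A where "spinor_of L A"
  using assms spinor_of_lorentz[of L]
  by (auto simp: proper_orthochronous_lorentz_def lorentz_def)

text \<open>Products of \<open>pauli 0\<close> and \<open>pauli 3\<close> fill the diagonal; the
  squares of \<open>pauli 1\<close> and \<open>pauli 2\<close> under the tensor product fill the
  antidiagonal.\<close>

lemma pauli_expansion_diag: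
  "pauli_expansion (mat_of_rows_list 4
      [[s0, 0, 0, 0], [0, s1, 0, 0], [0, 0, s2, 0], [0, 0, 0, s3]]) =
    x_mat (of_real ((s0 + s3) / 4)) (of_real ((s1 - s2) / 4))
      (of_real ((s0 - s3) / 4)) (of_real ((s1 + s2) / 4))
      (of_real ((s1 + s2) / 4)) (of_real ((s0 - s3) / 4))
      (of_real ((s1 - s2) / 4)) (of_real ((s0 + s3) / 4))"
  by (rule eq_mat_4I)
    (simp_all add: index_pauli_expansion index_pauli_kronecker lessThan_4 mat_of_rows_list_def field_simps)

text \<open>The corner entry \<open>a + c - b\<close> makes one diagonal entry vanish, and the
  opposite signs of \<open>d\<close> empty the inner antidiagonal. The zeros are written
  \<open>of_real 0\<close> to match the lemmas on real \<open>x_mat\<close> states.\<close>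

lemma pauli_expansion_non_diag:
  "pauli_expansion (mat_of_rows_list 4
      [[a, 0, 0, b], [0, d, 0, 0], [0, 0, - d, 0], [c, 0, 0, a + c - b]]) =
    x_mat (of_real ((a + c) / 2)) (of_real (d / 2)) (of_real 0) (of_real 0)
      (of_real 0) (of_real ((b - c) / 2)) (of_real (d / 2)) (of_real ((a - b) / 2))"
  by (rule eq_mat_4I)
    (simp_all add: index_pauli_expansion index_pauli_kronecker lessThan_4 mat_of_rows_list_def field_simps)

theorem theorem4:
  fixes \<rho> :: "complex mat" and R L1 L2 S :: "real mat"
  assumes "two_qubit_density_matrix \<rho>"
    and "R \<in> carrier_mat 4 4"
    and "\<And>i j. i < 4 \<Longrightarrow> j < 4 \<Longrightarrow>
           complex_of_real (R $$ (i, j)) = mat_trace (\<rho> * (pauli i \<otimes>\<^sub>m pauli j))"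
    and "proper_orthochronous_lorentz L1"
    and "proper_orthochronous_lorentz L2"
    and "R = L1 * S * transpose_mat L2"
  shows "(\<forall>s0 s1 s2 s3 :: real.
            S = mat_of_rows_list 4
                  [[s0, 0, 0, 0],
                   [0, s1, 0, 0],
                   [0, 0, s2, 0],
                   [0, 0, 0, s3]] \<and>
            s0 \<ge> s1 \<and> s1 \<ge> s2 \<and> s2 \<ge> \<bar>s3\<bar> \<longrightarrow>
            concurrence \<rho> = max 0 ((- s0 + s1 + s2 - s3) / 2)) \<and>
         (\<forall>a b c d :: real.
            S = mat_of_rows_list 4
                  [[a, 0, 0, b],
                   [0, d, 0, 0],
                   [0, 0, - d, 0],
                   [c, 0, 0, a + c - b]] \<longrightarrow>
            concurrence \<rho> = max 0 \<bar>d\<bar>)"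
proof -
  obtain A B where A: "spinor_of L1 A" and B: "spinor_of L2 B"
    using assms(4,5) by (elim proper_orthochronous_lorentz_spinor)
  define K where "K = A \<otimes>\<^sub>m B"
  have K: "spin_flip_isometry K"
    unfolding K_def using A B by (intro spin_flip_isometry_kronecker) (auto simp: spinor_of_def)
  have psd: "positive_semidefinite 4 \<rho>" using assms(1) by (simp add: two_qubit_density_matrix_def)
  then have \<rho>: "\<rho> = pauli_expansion R"
    by (intro pauli_expansion_of_traces assms(3)) (simp_all add: positive_semidefinite_def)
  \<comment> \<open>The size of \<open>S\<close> is known only once a normal form is given, hence
    the condition on \<open>S\<close>.\<close>
  have reduce: "concurrence \<rho> = concurrence (pauli_expansion S)"
    "positive_semidefinite 4 (pauli_expansion S)" if S: "S \<in> carrier_mat 4 4"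
  proof -
    have eq: "\<rho> = K * pauli_expansion S * mat_adjoint K"
      unfolding \<rho> assms(6) K_def by (rule pauli_expansion_congruence[OF A B S])
    show "concurrence \<rho> = concurrence (pauli_expansion S)"
      unfolding eq by (rule concurrence_congruence[OF K]) simp
    obtain L where L: "spin_flip_isometry L" "L * K = 1\<^sub>m 4"
      using spin_flip_isometry_inverse[OF K] .
    then have carr: "K \<in> carrier_mat 4 4" "L \<in> carrier_mat 4 4"
      using K by (auto simp: spin_flip_isometry_def)
    \<comment> \<open>Positivity is carried back to the normal form, where it supplies the block
      inequalities.\<close>
    have "L * \<rho> * mat_adjoint L = pauli_expansion S"
      unfolding eq by (rule congruence_cancel[OF carr _ L(2)]) simp
    then show "positive_semidefinite 4 (pauli_expansion S)"
      using positive_semidefinite_congruence[OF psd carr(2)] by simp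
  qed
  show ?thesis
  proof (intro conjI allI impI; (elim conjE)?)
    fix s0 s1 s2 s3 :: real
    assume S: "S = mat_of_rows_list 4 [[s0, 0, 0, 0], [0, s1, 0, 0], [0, 0, s2, 0], [0, 0, 0, s3]]"
      and s: "s0 \<ge> s1" "s1 \<ge> s2" "s2 \<ge> \<bar>s3\<bar>"
    have "S \<in> carrier_mat 4 4" by (rule carrier_matI) (simp_all add: S mat_of_rows_list_def)
    note red = reduce[OF this, unfolded S pauli_expansion_diag]
    note pos = positive_semidefinite_x_matD[OF red(2)]
    show "concurrence \<rho> = max 0 ((- s0 + s1 + s2 - s3) / 2)"
    proof -
      \<comment> \<open>Each block has equal diagonal entries, nonnegative by positivity, so the
        roots are the entries.\<close>
      have "sqrt ((s0 + s3) / 4 * ((s0 + s3) / 4)) = (s0 + s3) / 4"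
        "sqrt ((s0 - s3) / 4 * ((s0 - s3) / 4)) = (s0 - s3) / 4"
        using pos by (simp_all only: real_sqrt_abs2 abs_of_nonneg)
      moreover have "\<bar>(s1 - s2) / 4\<bar> = (s1 - s2) / 4" "\<bar>(s1 + s2) / 4\<bar> = (s1 + s2) / 4"
        using s by simp_all
      \<comment> \<open>The sides differ by \<open>(s2 - s3) / 2\<close>, so the ordering selects
        the second entry of the maximum.\<close>
      moreover have "(s1 - s2) / 4 - (s0 - s3) / 4 \<le> (s1 + s2) / 4 - (s0 + s3) / 4"
        using s(3) by (simp add: field_simps)
      moreover have "2 * ((s1 + s2) / 4 - (s0 + s3) / 4) = (- s0 + s1 + s2 - s3) / 2"
        by (simp add: field_simps)
      ultimately show ?thesis
        unfolding red(1) concurrence_x_state[OF pos] by (simp only: max_absorb2)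
    qed
  next
    fix a b c d :: real
    assume S: "S = mat_of_rows_list 4 [[a, 0, 0, b], [0, d, 0, 0], [0, 0, - d, 0], [c, 0, 0, a + c - b]]"
    have "S \<in> carrier_mat 4 4" by (rule carrier_matI) (simp_all add: S mat_of_rows_list_def)
    note red = reduce[OF this, unfolded S pauli_expansion_non_diag]
    note pos = positive_semidefinite_x_matD[OF red(2)]
    \<comment> \<open>The inner block has a zero diagonal entry and no off-diagonal part, so the
      second candidate is \<open>- g\<close>, which never exceeds the first.\<close>
    have "max 0 (2 * max (\<bar>d / 2\<bar> - 0) (\<bar>0\<bar> - g)) = max 0 \<bar>d\<bar>" if "g \<ge> 0" for g
      using that by (auto simp: max_def)
    moreover have "sqrt ((a + c) / 2 * ((a - b) / 2)) \<ge> 0" using pos by simp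
    ultimately show "concurrence \<rho> = max 0 \<bar>d\<bar>"
      unfolding red(1) concurrence_x_state[OF pos] by (simp only: mult_zero_left real_sqrt_zero)
  qed
qed

end
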